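(* Let $A$ be a quasi-Hopf (super)algebra, let $c_1\in A$ be even and invariant, let $c_2\in A$ be even and pseudo-invariant, and let $F\in A\otimes A$ be a twistor. Put $$C_1=\sum_\nu S(X_\nu)\alpha Y_\nu c_1S(Z_\nu),\qquad C_2=\sum_\nu S(X_\nu)c_2Y_\nu\beta S(Z_\nu),$$ $$c_1^F=\sum_i f_i\,c_1\,S(f^i),\qquad c_2^F=\sum_i S(\bar f_i)\,c_2\,\bar f^i,$$ $$C_1^F=\sum_\nu S(X^F_\nu)\alpha_F Y^F_\nu c_1^FS(Z^F_\nu),\qquad C_2^F=\sum_\nu S(X^F_\nu)c_2^FY^F_\nu\beta_F S(Z^F_\nu).$$ Then $C_1^F=C_1$ and $C_2^F=C_2$; that is, the central elements $C_1$ and $C_2$ are invariant under twisting.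
   Context: A quasi-Hopf (super)algebra $(A,\Delta,\epsilon,\Phi)$ is a unital associative $\mathbb Z_2$-graded algebra $A$ over a field $K$ (the ungraded case being $A$ concentrated in degree $0$; $[a]\in\mathbb Z_2$ is the degree of a homogeneous $a$; sign formulas are stated for homogeneous elements and extended linearly), with grading-preserving algebra homomorphisms $\epsilon:A\to K$, $\Delta:A\to A\otimes A$, an invertible homogeneous $\Phi\in A\otimes A\otimes A$, a graded algebra anti-homomorphism $S:A\to A$ (grading preserving, $S(ab)=(-1)^{[a][b]}S(b)S(a)$) and homogeneous $\alpha,\beta\in A$. Tensor products are multiplied by $(a\otimes b)(a'\otimes b')=(-1)^{[b][a']}aa'\otimes bb'$. Write $\Phi=\sum_\nu X_\nu\otimes Y_\nu\otimes Z_\nu$, $\Phi^{-1}=\sum_\nu\bar X_\nu\otimes\bar Y_\nu\otimes\bar Z_\nu$, $\Delta(a)=\sum a_{(1)}\otimes a_{(2)}$ (homogeneous components). The axioms are, for all $a\in A$: $(1\otimes\Delta)\Delta(a)=\Phi^{-1}(\Delta\otimes1)\Delta(a)\Phi$; $(\Delta\otimes1\otimes1)\Phi\cdot(1\otimes1\otimes\Delta)\Phi=(\Phi\otimes1)\cdot(1\otimes\Delta\otimes1)\Phi\cdot(1\otimes\Phi)$; $(\epsilon\otimes1)\Delta=1=(1\otimes\epsilon)\Delta$; $(1\otimes\epsilon\otimes1)\Phi=1$; $\sum S(a_{(1)})\alpha a_{(2)}=\epsilon(a)\alpha$; $\sum a_{(1)}\beta S(a_{(2)})=\epsilon(a)\beta$;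 $\sum\bar X_\nu\beta S(\bar Y_\nu)\alpha\bar Z_\nu=1$; $\sum S(X_\nu)\alpha Y_\nu\beta S(Z_\nu)=1$. These imply that $\Phi,\alpha,\beta$ are even. An element $c\in A$ is invariant if $\sum a_{(1)}cS(a_{(2)})(-1)^{[c][a_{(2)}]}=\epsilon(a)c$ for all $a\in A$, and pseudo-invariant if $\sum S(a_{(1)})c\,a_{(2)}(-1)^{[c][a_{(1)}]}=\epsilon(a)c$ for all $a\in A$. A twistor is an invertible homogeneous $F\in A\otimes A$ with $(\epsilon\otimes1)F=1=(1\otimes\epsilon)F$ (it is then even). Write $F=\sum_i f_i\otimes f^i$, $F^{-1}=\sum_i\bar f_i\otimes\bar f^i$. The twisted quasi-Hopf (super)algebra structure on $A$ has the same $\epsilon$ and $S$, and $\Delta_F(a)=F\Delta(a)F^{-1}$, $\Phi_F=(F\otimes1)\,(\Delta\otimes1)F\cdot\Phi\cdot(1\otimes\Delta)F^{-1}\,(1\otimes F^{-1})$, $\alpha_F=\sum_iS(\bar f_i)\alpha\bar f^i$, $\beta_F=\sum_if_i\beta S(f^i)$. Write $\Phi_F=\sum_\nu X^F_\nu\otimes Y^F_\nu\otimes Z^F_\nu$. *)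

theory Defs
  imports Complex_Main "HOL-Library.Poly_Mapping" "HOL-Library.Z2"
begin

section \<open>Superalgebras\<close>

record ('k, 'a) superalgebra_data =
  smult :: "'k \<Rightarrow> 'a \<Rightarrow> 'a"
  grade :: "bit \<Rightarrow> 'a set"

text \<open>The ring structure is that of the type \<open>'a\<close>. The class \<open>ring_1\<close> excludes only the zero
  ring, which cannot carry a unital homomorphism to a field.\<close>

locale superalgebra =
  fixes A :: "('k::field, 'a::ring_1, 'm) superalgebra_data_scheme" (structure)
  assumes vector_space_smult: "vector_space (smult A)"
    and smult_mult_left: "smult A k a * b = smult A k (a * b)"
    and smult_mult_right: "a * smult A k b = smult A k (a * b)"
    and subspace_grade: "module.subspace (smult A) (grade A d)"
    and grade_sum: "\<exists>x\<in>grade A 0. \<exists>y\<in>grade A 1. a = x + y"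
    and grade_inter: "grade A 0 \<inter> grade A 1 = {0}"
    and grade_one: "1 \<in> grade A 0"
    and grade_mult: "a \<in> grade A d \<Longrightarrow> b \<in> grade A e \<Longrightarrow> a * b \<in> grade A (d + e)"

definition component ::
  "('k, 'a::ring_1, 'm) superalgebra_data_scheme \<Rightarrow> bit \<Rightarrow> 'a \<Rightarrow> 'a" where
  "component A d a = (THE x. x \<in> grade A d \<and> a - x \<in> grade A (d + 1))"

definition sign :: "bit \<Rightarrow> int" where
  "sign d = (if d = 1 then -1 else 1)"


section \<open>Tensor powers\<close>

text \<open>
  The word \<open>[a\<^sub>1, \<dots>, a\<^sub>n]\<close> stands for \<open>a\<^sub>1 \<otimes> \<dots> \<otimes> a\<^sub>n\<close>. For \<open>n \<ge> 1\<close> the tensor power of \<open>A\<close>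
  over the ground field is the free abelian group on the words of length \<open>n\<close> modulo the subgroup
  generated by additivity in each slot and by moving scalars between two slots. All lengths are
  treated at once, so a tensor is a coset in the direct sum of these quotients. (The component
  \<open>n = 0\<close> comes out as the integers and plays no role.)
\<close>

type_synonym 'a formal = "'a list \<Rightarrow>\<^sub>0 int"
type_synonym 'a tensor = "'a formal set"

inductive_set tnull :: "('k, 'a::ring_1, 'm) superalgebra_data_scheme \<Rightarrow> 'a formal set"
  for A where
  zero: "0 \<in> tnull A"
| diff: "s \<in> tnull A \<Longrightarrow> t \<in> tnull A \<Longrightarrow> s - t \<in> tnull A"
| additive: "frag_of (xs @ [a + b] @ ys) - frag_of (xs @ [a] @ ys) - frag_of (xs @ [b] @ ys)
    \<in> tnull A"
| balanced: "frag_of (xs @ [smult A k a] @ ys @ [b] @ zs)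
    - frag_of (xs @ [a] @ ys @ [smult A k b] @ zs) \<in> tnull A"

definition tclass ::
  "('k, 'a::ring_1, 'm) superalgebra_data_scheme \<Rightarrow> 'a formal \<Rightarrow> 'a tensor" where
  "tclass A s = {t. t - s \<in> tnull A}"

text \<open>An expression of a tensor as a finite sum of pure tensors. The operations below are
  computed on such an expression by additive maps that preserve the relations \<open>tnull\<close>, so they
  do not depend on the choice. In particular they are zero on words of an unsuitable length.\<close>

definition rep :: "'a tensor \<Rightarrow> 'a formal" where
  "rep X = (SOME s. s \<in> X)"

definition tpower ::
  "('k, 'a::ring_1, 'm) superalgebra_data_scheme \<Rightarrow> nat \<Rightarrow> 'a tensor set" where
  "tpower A n = {tclass A s | s. \<forall>w\<in>Poly_Mapping.keys s. length w = n}"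

definition tgrade ::
  "('k, 'a::ring_1, 'm) superalgebra_data_scheme \<Rightarrow> nat \<Rightarrow> bit \<Rightarrow> 'a tensor set" where
  "tgrade A n d = {tclass A s | s. \<forall>w\<in>Poly_Mapping.keys s. length w = n \<and>
     (\<exists>ds. list_all2 (\<lambda>e a. a \<in> grade A e) ds w \<and> sum_list ds = d)}"

definition pure ::
  "('k, 'a::ring_1, 'm) superalgebra_data_scheme \<Rightarrow> 'a list \<Rightarrow> 'a tensor" where
  "pure A w = tclass A (frag_of w)"

definition tadd :: "('k, 'a::ring_1, 'm) superalgebra_data_scheme
    \<Rightarrow> 'a tensor \<Rightarrow> 'a tensor \<Rightarrow> 'a tensor" (infixl \<open>\<oplus>\<index>\<close> 65) where
  "X \<oplus>\<^bsub>A\<^esub> Y = tclass A (rep X + rep Y)"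

definition word_smult :: "('k, 'a::ring_1, 'm) superalgebra_data_scheme
    \<Rightarrow> 'k \<Rightarrow> 'a list \<Rightarrow> 'a formal" where
  "word_smult A k w = (case w of [] \<Rightarrow> 0 | x # xs \<Rightarrow> frag_of (smult A k x # xs))"

definition tsmult :: "('k, 'a::ring_1, 'm) superalgebra_data_scheme
    \<Rightarrow> 'k \<Rightarrow> 'a tensor \<Rightarrow> 'a tensor" where
  "tsmult A k X = tclass A (frag_extend (word_smult A k) (rep X))"

definition juxtapose :: "'a formal \<Rightarrow> 'a formal \<Rightarrow> 'a formal" where
  "juxtapose s t = frag_extend (\<lambda>xs. frag_extend (\<lambda>ys. frag_of (xs @ ys)) t) s"

definition tjoin :: "('k, 'a::ring_1, 'm) superalgebra_data_scheme
    \<Rightarrow> 'a tensor \<Rightarrow> 'a tensor \<Rightarrow> 'a tensor" (infixl \<open>\<otimes>\<index>\<close> 75) where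
  "X \<otimes>\<^bsub>A\<^esub> Y = tclass A (juxtapose (rep X) (rep Y))"

text \<open>The product of \<open>a\<^sub>1 \<otimes> \<dots> \<otimes> a\<^sub>n\<close> and \<open>b\<^sub>1 \<otimes> \<dots> \<otimes> b\<^sub>n\<close>, of degrees \<open>ds\<close> and \<open>es\<close>, carries the
  sign of \<open>koszul ds es\<close>, because \<open>b\<^sub>j\<close> moves past every \<open>a\<^sub>i\<close> with \<open>i > j\<close>. Arbitrary entries are
  first split into homogeneous components.\<close>

definition koszul :: "bit list \<Rightarrow> bit list \<Rightarrow> bit" where
  "koszul ds es = (\<Sum>i<length ds. \<Sum>j<i. ds ! i * es ! j)"

definition word_mult :: "('k, 'a::ring_1, 'm) superalgebra_data_scheme
    \<Rightarrow> 'a list \<Rightarrow> 'a list \<Rightarrow> 'a formal" where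
  "word_mult A xs ys = (if length xs = length ys then
     (\<Sum>ds | length ds = length xs. \<Sum>es | length es = length ys.
        frag_cmul (sign (koszul ds es))
          (frag_of (map2 (*) (map2 (component A) ds xs) (map2 (component A) es ys))))
     else 0)"

definition tmult :: "('k, 'a::ring_1, 'm) superalgebra_data_scheme
    \<Rightarrow> 'a tensor \<Rightarrow> 'a tensor \<Rightarrow> 'a tensor" (infixl \<open>\<odot>\<index>\<close> 70) where
  "X \<odot>\<^bsub>A\<^esub> Y =
     tclass A (frag_extend (\<lambda>xs. frag_extend (word_mult A xs) (rep Y)) (rep X))"

definition tone :: "('k, 'a::ring_1, 'm) superalgebra_data_scheme \<Rightarrow> nat \<Rightarrow> 'a tensor" where
  "tone A n = pure A (replicate n 1)"

definition is_tinverse :: "('k, 'a::ring_1, 'm) superalgebra_data_scheme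
    \<Rightarrow> nat \<Rightarrow> 'a tensor \<Rightarrow> 'a tensor \<Rightarrow> bool" where
  "is_tinverse A n X Y \<longleftrightarrow>
     Y \<in> tpower A n \<and> X \<odot>\<^bsub>A\<^esub> Y = tone A n \<and> Y \<odot>\<^bsub>A\<^esub> X = tone A n"

definition tinvertible :: "('k, 'a::ring_1, 'm) superalgebra_data_scheme
    \<Rightarrow> nat \<Rightarrow> 'a tensor \<Rightarrow> bool" where
  "tinvertible A n X \<longleftrightarrow> X \<in> tpower A n \<and> (\<exists>Y. is_tinverse A n X Y)"

definition tinverse :: "('k, 'a::ring_1, 'm) superalgebra_data_scheme
    \<Rightarrow> nat \<Rightarrow> 'a tensor \<Rightarrow> 'a tensor" where
  "tinverse A n X = (THE Y. is_tinverse A n X Y)"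

text \<open>\<open>\<Sum> f x\<^sub>\<nu> y\<^sub>\<nu>\<close> for \<open>X = \<Sum> x\<^sub>\<nu> \<otimes> y\<^sub>\<nu>\<close> and multilinear \<open>f\<close>, and similarly with three factors.\<close>

definition contract :: "('a list \<Rightarrow> 'b::ring_1) \<Rightarrow> 'a tensor \<Rightarrow> 'b" where
  "contract f X =
     (\<Sum>w\<in>Poly_Mapping.keys (rep X). of_int (Poly_Mapping.lookup (rep X) w) * f w)"

definition contract2 :: "('a \<Rightarrow> 'a \<Rightarrow> 'b::ring_1) \<Rightarrow> 'a tensor \<Rightarrow> 'b" where
  "contract2 f = contract (\<lambda>w. case w of [x, y] \<Rightarrow> f x y | _ \<Rightarrow> 0)"

definition contract3 :: "('a \<Rightarrow> 'a \<Rightarrow> 'a \<Rightarrow> 'b::ring_1) \<Rightarrow> 'a tensor \<Rightarrow> 'b" where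
  "contract3 f = contract (\<lambda>w. case w of [x, y, z] \<Rightarrow> f x y z | _ \<Rightarrow> 0)"


section \<open>Quasi-Hopf superalgebras\<close>

record ('k, 'a) quasi_hopf_data = "('k, 'a) superalgebra_data" +
  comult :: "'a \<Rightarrow> 'a tensor"
  counit :: "'a \<Rightarrow> 'k"
  coassoc :: "'a tensor"
  antipode :: "'a \<Rightarrow> 'a"
  alpha :: 'a
  beta :: 'a

text \<open>\<open>1 \<otimes> \<dots> \<otimes> \<Delta> \<otimes> \<dots> \<otimes> 1\<close> and \<open>1 \<otimes> \<dots> \<otimes> \<epsilon> \<otimes> \<dots> \<otimes> 1\<close>, with the map in slot \<open>i\<close> (counted from 0).
  In the latter the scalar is absorbed into the first remaining slot.\<close>

definition comult_at ::
  "('k, 'a::ring_1) quasi_hopf_data \<Rightarrow> nat \<Rightarrow> 'a tensor \<Rightarrow> 'a tensor" where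
  "comult_at Q i X = tclass Q (frag_extend (\<lambda>w. if i < length w then
       juxtapose (frag_of (take i w))
         (juxtapose (rep (comult Q (w ! i))) (frag_of (drop (Suc i) w)))
     else 0) (rep X))"

definition counit_at ::
  "('k, 'a::ring_1) quasi_hopf_data \<Rightarrow> nat \<Rightarrow> 'a tensor \<Rightarrow> 'a tensor" where
  "counit_at Q i X = tclass Q (frag_extend (\<lambda>w. if i < length w then
       word_smult Q (counit Q (w ! i)) (take i w @ drop (Suc i) w)
     else 0) (rep X))"

locale quasi_hopf_superalgebra = superalgebra Q
  for Q :: "('k::field, 'a::ring_1) quasi_hopf_data" (structure) +
  assumes counit_linear: "Vector_Spaces.linear (smult Q) (*) (counit Q)"
    and counit_mult: "counit Q (a * b) = counit Q a * counit Q b"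
    and counit_one: "counit Q 1 = 1"
    and counit_grade: "a \<in> grade Q 1 \<Longrightarrow> counit Q a = 0"
    and comult_tpower: "comult Q a \<in> tpower Q 2"
    and comult_add: "comult Q (a + b) = comult Q a \<oplus> comult Q b"
    and comult_smult: "comult Q (smult Q k a) = tsmult Q k (comult Q a)"
    and comult_mult: "comult Q (a * b) = comult Q a \<odot> comult Q b"
    and comult_one: "comult Q 1 = tone Q 2"
    and comult_grade: "a \<in> grade Q d \<Longrightarrow> comult Q a \<in> tgrade Q 2 d"
    and coassoc_invertible: "tinvertible Q 3 (coassoc Q)"
    and coassoc_homogeneous: "\<exists>d. coassoc Q \<in> tgrade Q 3 d"
    and antipode_linear: "Vector_Spaces.linear (smult Q) (smult Q) (antipode Q)"
    and antipode_grade: "a \<in> grade Q d \<Longrightarrow> antipode Q a \<in> grade Q d"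
    and antipode_mult: "a \<in> grade Q d \<Longrightarrow> b \<in> grade Q e \<Longrightarrow>
      antipode Q (a * b) = of_int (sign (d * e)) * (antipode Q b * antipode Q a)"
    and antipode_one: "antipode Q 1 = 1"
    and alpha_homogeneous: "\<exists>d. alpha Q \<in> grade Q d"
    and beta_homogeneous: "\<exists>d. beta Q \<in> grade Q d"
    and quasi_coassociative: "comult_at Q 1 (comult Q a) =
      tinverse Q 3 (coassoc Q) \<odot> comult_at Q 0 (comult Q a) \<odot> coassoc Q"
    and pentagon: "comult_at Q 0 (coassoc Q) \<odot> comult_at Q 2 (coassoc Q) =
      (coassoc Q \<otimes> pure Q [1]) \<odot> comult_at Q 1 (coassoc Q) \<odot> (pure Q [1] \<otimes> coassoc Q)"
    and counit_left: "counit_at Q 0 (comult Q a) = pure Q [a]"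
    and counit_right: "counit_at Q 1 (comult Q a) = pure Q [a]"
    and counit_coassoc: "counit_at Q 1 (coassoc Q) = tone Q 2"
    and antipode_alpha:
      "contract2 (\<lambda>x y. antipode Q x * alpha Q * y) (comult Q a) = smult Q (counit Q a) (alpha Q)"
    and antipode_beta:
      "contract2 (\<lambda>x y. x * beta Q * antipode Q y) (comult Q a) = smult Q (counit Q a) (beta Q)"
    and antipode_coassoc_inverse:
      "contract3 (\<lambda>x y z. x * beta Q * antipode Q y * alpha Q * z) (tinverse Q 3 (coassoc Q)) = 1"
    and antipode_coassoc:
      "contract3 (\<lambda>x y z. antipode Q x * alpha Q * y * beta Q * antipode Q z) (coassoc Q) = 1"

definition invariant :: "('k, 'a::ring_1) quasi_hopf_data \<Rightarrow> 'a \<Rightarrow> bool" where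
  "invariant Q c \<longleftrightarrow> (\<forall>a. contract2 (\<lambda>x y. \<Sum>d\<in>UNIV. \<Sum>e\<in>UNIV.
       of_int (sign (d * e)) * (x * component Q d c * antipode Q (component Q e y))) (comult Q a)
     = smult Q (counit Q a) c)"

definition pseudo_invariant :: "('k, 'a::ring_1) quasi_hopf_data \<Rightarrow> 'a \<Rightarrow> bool" where
  "pseudo_invariant Q c \<longleftrightarrow> (\<forall>a. contract2 (\<lambda>x y. \<Sum>d\<in>UNIV. \<Sum>e\<in>UNIV.
       of_int (sign (d * e)) * (antipode Q (component Q e x) * component Q d c * y)) (comult Q a)
     = smult Q (counit Q a) c)"


section \<open>Twisting\<close>

definition twistor :: "('k, 'a::ring_1) quasi_hopf_data \<Rightarrow> 'a tensor \<Rightarrow> bool" where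
  "twistor Q F \<longleftrightarrow> tinvertible Q 2 F \<and> (\<exists>d. F \<in> tgrade Q 2 d) \<and>
     counit_at Q 0 F = pure Q [1] \<and> counit_at Q 1 F = pure Q [1]"

definition twist ::
  "('k, 'a::ring_1) quasi_hopf_data \<Rightarrow> 'a tensor \<Rightarrow> ('k, 'a) quasi_hopf_data" where
  "twist Q F = Q\<lparr>
     comult := \<lambda>a. F \<odot>\<^bsub>Q\<^esub> comult Q a \<odot>\<^bsub>Q\<^esub> tinverse Q 2 F,
     coassoc := (F \<otimes>\<^bsub>Q\<^esub> pure Q [1]) \<odot>\<^bsub>Q\<^esub> comult_at Q 0 F \<odot>\<^bsub>Q\<^esub> coassoc Q
       \<odot>\<^bsub>Q\<^esub> comult_at Q 1 (tinverse Q 2 F) \<odot>\<^bsub>Q\<^esub> (pure Q [1] \<otimes>\<^bsub>Q\<^esub> tinverse Q 2 F),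
     alpha := contract2 (\<lambda>x y. antipode Q x * alpha Q * y) (tinverse Q 2 F),
     beta := contract2 (\<lambda>x y. x * beta Q * antipode Q y) F\<rparr>"

definition twist_invariant ::
  "('k, 'a::ring_1) quasi_hopf_data \<Rightarrow> 'a tensor \<Rightarrow> 'a \<Rightarrow> 'a" where
  "twist_invariant Q F c = contract2 (\<lambda>x y. x * c * antipode Q y) F"

definition twist_pseudo_invariant ::
  "('k, 'a::ring_1) quasi_hopf_data \<Rightarrow> 'a tensor \<Rightarrow> 'a \<Rightarrow> 'a" where
  "twist_pseudo_invariant Q F c =
     contract2 (\<lambda>x y. antipode Q x * c * y) (tinverse Q 2 F)"

definition central1 :: "('k, 'a::ring_1) quasi_hopf_data \<Rightarrow> 'a \<Rightarrow> 'a" where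
  "central1 Q c =
     contract3 (\<lambda>x y z. antipode Q x * alpha Q * y * c * antipode Q z) (coassoc Q)"

definition central2 :: "('k, 'a::ring_1) quasi_hopf_data \<Rightarrow> 'a \<Rightarrow> 'a" where
  "central2 Q c =
     contract3 (\<lambda>x y z. antipode Q x * c * y * beta Q * antipode Q z) (coassoc Q)"

end

theory Submission
  imports Defs
begin

text \<open>
  For \<open>a, b \<in> A\<close> let \<open>m\<^bsub>a,b\<^esub>(x \<otimes> y \<otimes> z) = S(x) a y b S(z)\<close>. Then \<open>C\<^sub>1 = m\<^bsub>a,b\<^esub>(\<Phi>)\<close> for
  \<open>(a, b) = (\<alpha>, c\<^sub>1)\<close> and \<open>C\<^sub>2 = m\<^bsub>a,b\<^esub>(\<Phi>)\<close> for \<open>(a, b) = (c\<^sub>2, \<beta>)\<close>. In both cases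
  \<open>\<Sum> S(x\<^sub>1) a x\<^sub>2 = \<epsilon>(x) a\<close> and \<open>\<Sum> x\<^sub>1 b S(x\<^sub>2) = \<epsilon>(x) b\<close> for \<open>\<Delta>(x) = \<Sum> x\<^sub>1 \<otimes> x\<^sub>2\<close>, and these two
  equations drive the argument.

  Let \<open>G = F\<^sup>-\<^sup>1\<close>, \<open>a\<^sub>F = \<Sum> S(g\<^sub>1) a g\<^sub>2\<close> and \<open>b\<^sub>F = \<Sum> f\<^sub>1 b S(f\<^sub>2)\<close>. Because \<open>S\<close> reverses products,
  \<open>m\<^bsub>a\<^sub>F,b\<^sub>F\<^esub>(T) = m\<^bsub>a,b\<^esub>((G \<otimes> 1) T (1 \<otimes> F))\<close> (lemmas \<open>sandwich_left_factor\<close> and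
  \<open>sandwich_right_factor\<close>). For \<open>T = \<Phi>\<^sub>F\<close> the outer factors cancel, and what remains is
  \<open>m\<^bsub>a,b\<^esub>((\<Delta> \<otimes> 1)F \<cdot> \<Phi> \<cdot> (1 \<otimes> \<Delta>)G)\<close>. The factor \<open>(\<Delta> \<otimes> 1)F\<close> enters as \<open>\<Sum> S(f\<^sub>1) a f\<^sub>2 = \<epsilon>(f) a\<close> and
  disappears by \<open>(\<epsilon> \<otimes> 1)F = 1\<close>, and the factor \<open>(1 \<otimes> \<Delta>)G\<close> disappears in the same way by
  \<open>(1 \<otimes> \<epsilon>)G = 1\<close> (lemmas \<open>sandwich_comult_left\<close> and \<open>sandwich_comult_right\<close>). This leaves
  \<open>m\<^bsub>a,b\<^esub>(\<Phi>)\<close>.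

  The Koszul signs of the products and those of \<open>S\<close> cancel as soon as the two legs of \<open>F\<close>, and
  likewise those of \<open>G\<close>, have equal degrees. That \<open>F\<close> is even follows from its counit
  normalization, because \<open>\<epsilon>\<close> vanishes in degree 1 (lemma \<open>twistor_even\<close>). That \<open>G\<close> is even follows
  from the uniqueness of inverses: the even part of \<open>G\<close> is again a right inverse of \<open>F\<close>
  (lemma \<open>tinverse_even\<close>).

  The computations take place on formal sums of words, modulo the relations of the tensor product.
  Every map involved is additive and respects these relations, so identities need to be checked
  only on words of homogeneous letters, where a product is a single word with a single sign.
\<close>

section \<open>Additive extension of functions on words\<close>

text \<open>The same sum as in \<open>contract\<close>, but on formal sums instead of tensors: it is additive for every \<open>f\<close>,
whereas \<open>contract f\<close> is well behaved only for multilinear \<open>f\<close>.\<close>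

definition feval :: "('a list \<Rightarrow> 'b::ring_1) \<Rightarrow> 'a formal \<Rightarrow> 'b" where
  "feval f s = (\<Sum>w\<in>Poly_Mapping.keys s. of_int (Poly_Mapping.lookup s w) * f w)"

lemma contract_feval: "contract f X = feval f (rep X)"
  by (simp add: contract_def feval_def)

lemma feval_superset:
  assumes "finite I" "Poly_Mapping.keys s \<subseteq> I"
  shows "feval f s = (\<Sum>w\<in>I. of_int (Poly_Mapping.lookup s w) * f w)"
  unfolding feval_def
  by (rule sum.mono_neutral_left) (use assms in \<open>auto simp: in_keys_iff\<close>)

lemma feval_zero [simp]: "feval f 0 = 0"
  by (simp add: feval_def)

lemma feval_of [simp]: "feval f (frag_of w) = f w"
  by (simp add: feval_def)

lemma feval_add: "feval f (s + t) = feval f s + feval f t"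
proof -
  let ?I = "Poly_Mapping.keys s \<union> Poly_Mapping.keys t"
  have "Poly_Mapping.keys (s + t) \<subseteq> ?I"
    by (rule keys_add)
  then show ?thesis
    by (simp add: feval_superset[of ?I] lookup_add distrib_right sum.distrib)
qed

lemma feval_cmul: "feval f (frag_cmul k s) = of_int k * feval f s"
proof -
  have "Poly_Mapping.keys (frag_cmul k s) \<subseteq> Poly_Mapping.keys s"
    by (rule keys_cmul)
  then show ?thesis
    by (simp add: feval_superset[of "Poly_Mapping.keys s"] sum_distrib_left mult.assoc)
qed

lemma feval_minus: "feval f (- s) = - feval f s"
  using feval_cmul[of f "-1" s] by simp

lemma feval_diff: "feval f (s - t) = feval f s - feval f t"
  using feval_add[of f s "- t"] by (simp add: feval_minus)

lemma feval_sum: "feval f (sum g I) = (\<Sum>i\<in>I. feval f (g i))"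
  by (induction I rule: infinite_finite_induct) (simp_all add: feval_add)

lemma feval_frag_extend: "feval f (frag_extend g s) = feval (\<lambda>w. feval f (g w)) s"
  by (simp add: frag_extend_def feval_sum feval_cmul feval_def[of "\<lambda>w. feval f (g w)"])

lemma frag_cmul_diff_right: "frag_cmul k (s - t) = frag_cmul k s - frag_cmul k t"
  by (rule poly_mapping_eqI) (simp add: lookup_minus right_diff_distrib)

lemma keys_frag_extendE:
  assumes "v \<in> Poly_Mapping.keys (frag_extend f s)"
  obtains w where "w \<in> Poly_Mapping.keys s" "v \<in> Poly_Mapping.keys (f w)"
  using assms keys_frag_extend[of f s] by blast

section \<open>Homogeneous components\<close>

(* Rewriting bit arithmetic into Boolean operations would destroy the sums of products of degrees
   in which the signs are computed. *)
declare add_bit_eq_xor [simp del] and mult_bit_eq_and [simp del]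

lemma bit_add_self [simp]: "a + a = (0::bit)"
  by (cases a) simp_all

lemma UNIV_bit: "(UNIV :: bit set) = {0, 1}"
proof -
  have "x \<in> {0, 1}" for x :: bit
    by (cases x) auto
  then show ?thesis
    by auto
qed

lemma finite_bit_lists [simp]: "finite {ds :: bit list. length ds = n}"
proof -
  have "finite {ds :: bit list. set ds \<subseteq> UNIV \<and> length ds = n}"
    by (rule finite_lists_length_eq) (simp add: UNIV_bit)
  then show ?thesis
    by simp
qed

lemma sign_add: "sign (d + e) = sign d * sign e"
  by (cases d; cases e) (simp_all add: sign_def)

lemma sign_zero [simp]: "sign 0 = 1"
  by (simp add: sign_def)

context superalgebra
begin

sublocale vs: vector_space "smult A"
  by (rule vector_space_smult)

lemmas grade_zero [simp, intro] = vs.subspace_0[OF subspace_grade]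
  and grade_add = vs.subspace_add[OF subspace_grade]
  and grade_diff = vs.subspace_diff[OF subspace_grade]
  and grade_smult = vs.subspace_scale[OF subspace_grade]

lemma grade_disjoint: "a \<in> grade A d \<Longrightarrow> a \<in> grade A (d + 1) \<Longrightarrow> a = 0"
  using grade_inter by (cases d) auto

lemma component_eqI:
  assumes "x \<in> grade A d" "a - x \<in> grade A (d + 1)"
  shows "component A d a = x"
  unfolding component_def
proof (rule the_equality)
  fix y assume y: "y \<in> grade A d \<and> a - y \<in> grade A (d + 1)"
  have "y - x = (a - x) - (a - y)"
    by simp
  then have "y - x \<in> grade A (d + 1)"
    using assms y by (metis grade_diff)
  then show "y = x"
    using grade_disjoint[of "y - x" d] grade_diff[of y d x] assms y by simp
qed (use assms in simp)

lemma component_exists: "\<exists>x\<in>grade A d. a - x \<in> grade A (d + 1)"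
proof -
  obtain x y where xy: "x \<in> grade A 0" "y \<in> grade A 1" "a = x + y"
    using grade_sum by blast
  show ?thesis
  proof (cases "d = 0")
    case True
    with xy show ?thesis by (intro bexI[of _ x]) simp_all
  next
    case False
    with xy show ?thesis by (intro bexI[of _ y]) simp_all
  qed
qed

lemma component_grade [intro]: "component A d a \<in> grade A d"
  using component_exists component_eqI by metis

lemma component_rest: "a - component A d a \<in> grade A (d + 1)"
  using component_exists component_eqI by metis

lemma component_homogeneous:
  assumes "a \<in> grade A e"
  shows "component A d a = (if d = e then a else 0)"
proof (cases "d = e")
  case False
  then have "e = d + 1"
    by (cases d; cases e) auto
  with assms False show ?thesis
    by (auto intro!: component_eqI)
qed (use assms in \<open>auto intro!: component_eqI\<close>)

lemma component_add: "component A d (a + b) = component A d a + component A d b"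
proof (rule component_eqI)
  have "a + b - (component A d a + component A d b)
      = (a - component A d a) + (b - component A d b)"
    by simp
  then show "a + b - (component A d a + component A d b) \<in> grade A (d + 1)"
    by (simp only: grade_add[OF component_rest component_rest])
qed (intro grade_add component_grade)

lemma component_smult: "component A d (smult A k a) = smult A k (component A d a)"
  by (rule component_eqI)
    (simp_all add: grade_smult component_grade component_rest flip: vs.scale_right_diff_distrib)

lemma component_sum: "component A 0 a + component A 1 a = a"
proof -
  have "component A 1 a = a - component A 0 a"
    using component_rest[of a 0] by (intro component_eqI) auto
  then show ?thesis
    by simp
qed

section \<open>The congruence of formal tensors\<close>

definition teq :: "'a formal \<Rightarrow> 'a formal \<Rightarrow> bool"  (infix \<open>\<simeq>\<close> 50) where
  "s \<simeq> t \<longleftrightarrow> s - t \<in> tnull A"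

lemma tnull_minus: "s \<in> tnull A \<Longrightarrow> - s \<in> tnull A"
  using tnull.diff[OF tnull.zero] by fastforce

lemma tnull_add: "s \<in> tnull A \<Longrightarrow> t \<in> tnull A \<Longrightarrow> s + t \<in> tnull A"
  using tnull.diff[OF _ tnull_minus] by fastforce

lemma teq_refl [simp, intro]: "s \<simeq> s"
  by (simp add: teq_def tnull.zero)

lemma teq_sym: "s \<simeq> t \<Longrightarrow> t \<simeq> s"
  unfolding teq_def using tnull_minus by fastforce

lemma teq_trans [trans]: "s \<simeq> t \<Longrightarrow> t \<simeq> u \<Longrightarrow> s \<simeq> u"
  unfolding teq_def using tnull_add by fastforce

lemma teq_add:
  assumes "s \<simeq> s'" "t \<simeq> t'" shows "s + t \<simeq> s' + t'"
proof -
  have "s + t - (s' + t') = (s - s') + (t - t')"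
    by simp
  then show ?thesis
    using assms unfolding teq_def by (metis tnull_add)
qed

lemma teq_diff:
  assumes "s \<simeq> s'" "t \<simeq> t'" shows "s - t \<simeq> s' - t'"
proof -
  have "s - t - (s' - t') = (s - s') - (t - t')"
    by simp
  then show ?thesis
    using assms unfolding teq_def by (metis tnull.diff)
qed

lemma teq_sum: "(\<And>i. i \<in> I \<Longrightarrow> f i \<simeq> g i) \<Longrightarrow> sum f I \<simeq> sum g I"
  by (induction I rule: infinite_finite_induct) (auto intro: teq_add)

lemma teq_cmul: "s \<simeq> t \<Longrightarrow> frag_cmul k s \<simeq> frag_cmul k t"
  unfolding teq_def frag_cmul_diff_right[symmetric]
  by (rule frag_closure_minus_cmul) (auto intro: tnull.zero tnull.diff)

lemma teq_frag_extend_pointwise: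
  "(\<And>w. w \<in> Poly_Mapping.keys s \<Longrightarrow> f w \<simeq> g w) \<Longrightarrow> frag_extend f s \<simeq> frag_extend g s"
  unfolding frag_extend_def by (intro teq_sum teq_cmul)

text \<open>The criterion by which every operation below is seen to descend to tensors: a map on words that
respects the two kinds of generating relations respects all of \<open>tnull\<close>.\<close>

lemma teq_frag_extend:
  assumes "\<And>xs a b ys. f (xs @ [a + b] @ ys) \<simeq> f (xs @ [a] @ ys) + f (xs @ [b] @ ys)"
    and "\<And>xs a ys b zs k. f (xs @ [smult A k a] @ ys @ [b] @ zs) \<simeq> f (xs @ [a] @ ys @ [smult A k b] @ zs)"
    and "s \<simeq> t"
  shows "frag_extend f s \<simeq> frag_extend f t"
proof -
  have "frag_extend f u \<in> tnull A" if "u \<in> tnull A" for u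
    using that
  proof induction
    case (additive xs a b ys)
    then show ?case
      using assms(1)[of xs a b ys]
      by (simp add: frag_extend_diff frag_extend_add teq_def diff_diff_eq)
  next
    case (balanced xs k a ys b zs)
    then show ?case
      using assms(2)[of xs k a ys b zs] by (simp add: frag_extend_diff teq_def)
  qed (auto simp: frag_extend_diff intro: tnull.intros)
  then show ?thesis
    using assms(3) by (simp add: teq_def frag_extend_diff[symmetric])
qed

lemma feval_teq:
  assumes "\<And>xs a b ys. f (xs @ [a + b] @ ys) = f (xs @ [a] @ ys) + f (xs @ [b] @ ys)"
    and "\<And>xs a ys b zs k. f (xs @ [smult A k a] @ ys @ [b] @ zs) = f (xs @ [a] @ ys @ [smult A k b] @ zs)"
    and "s \<simeq> t"
  shows "feval f s = feval f t"
proof -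
  have "feval f u = 0" if "u \<in> tnull A" for u
    using that
  proof induction
    case (additive xs a b ys)
    then show ?case
      using assms(1)[of xs a b ys] by (simp add: feval_diff)
  next
    case (balanced xs k a ys b zs)
    then show ?case
      using assms(2)[of xs k a ys b zs] by (simp add: feval_diff)
  qed (auto simp: feval_diff)
  from this[of "s - t"] show ?thesis
    using assms(3) by (simp add: teq_def feval_diff)
qed

lemma tclass_eq_iff: "tclass A s = tclass A t \<longleftrightarrow> s \<simeq> t"
proof
  assume "tclass A s = tclass A t"
  moreover have "s \<in> tclass A s"
    by (simp add: tclass_def tnull.zero)
  ultimately show "s \<simeq> t"
    by (simp add: tclass_def teq_def)
next
  assume st: "s \<simeq> t"
  show "tclass A s = tclass A t"
    unfolding tclass_def using st teq_trans teq_sym unfolding teq_def by blast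
qed

text \<open>The choice made by \<open>rep\<close> is harmless as long as it enters only through operations that respect
the congruence.\<close>

lemma rep_tclass: "rep (tclass A s) \<simeq> s"
proof -
  have "s \<in> tclass A s"
    by (simp add: tclass_def tnull.zero)
  then have "rep (tclass A s) \<in> tclass A s"
    unfolding rep_def by (rule someI)
  then show ?thesis
    by (simp add: tclass_def teq_def)
qed

text \<open>A word with a letter 0 is not the formal sum 0, but additivity with both summands 0 makes it a
relation. Such words arise when a homogeneous letter is split into its components.\<close>

lemma teq_zero_letter:
  assumes "0 \<in> set w" shows "frag_of w \<simeq> 0"
proof -
  obtain xs ys where w: "w = xs @ [0] @ ys"
    using assms by (metis append_Cons append_Nil split_list)
  then show ?thesis
    using tnull_minus[OF tnull.additive[of xs 0 0 ys A]] by (simp add: teq_def)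
qed

section \<open>Homogeneous words\<close>

definition hom_word :: "bit list \<Rightarrow> 'a list \<Rightarrow> bool" where
  "hom_word ds w \<longleftrightarrow> list_all2 (\<lambda>e a. a \<in> grade A e) ds w"

lemma hom_word_length: "hom_word ds w \<Longrightarrow> length ds = length w"
  by (auto simp: hom_word_def list_all2_lengthD)

lemma hom_word_simps [simp]:
  "hom_word [] w \<longleftrightarrow> w = []"
  "hom_word ds [] \<longleftrightarrow> ds = []"
  "hom_word (d # ds) (a # w) \<longleftrightarrow> a \<in> grade A d \<and> hom_word ds w"
  by (auto simp: hom_word_def)

lemma hom_word_nth: "hom_word ds w \<Longrightarrow> i < length w \<Longrightarrow> w ! i \<in> grade A (ds ! i)"
  by (auto simp: hom_word_def list_all2_conv_all_nth)

lemma hom_word_append: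
  "length ds = length v \<Longrightarrow> hom_word (ds @ es) (v @ w) \<longleftrightarrow> hom_word ds v \<and> hom_word es w"
  by (simp add: hom_word_def list_all2_append)

lemma hom_word_mult:
  "hom_word ds v \<Longrightarrow> hom_word es w \<Longrightarrow> hom_word (map2 (+) ds es) (map2 (*) v w)"
  by (auto simp: hom_word_def list_all2_conv_all_nth intro!: grade_mult)

lemma hom_word_replicate_one: "hom_word (replicate n 0) (replicate n 1)"
  by (induction n) (auto simp: grade_one)

lemma hom_word_component: "length ds = length w \<Longrightarrow> hom_word ds (map2 (component A) ds w)"
  by (auto simp: hom_word_def list_all2_conv_all_nth)

text \<open>Of the \<open>2\<^sup>n\<close> ways to pick a component of each letter of a homogeneous word, only the one that
agrees with its degrees gives something nonzero.\<close>

lemma map2_component: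
  assumes "hom_word ds w" "length es = length w"
  shows "es = ds \<Longrightarrow> map2 (component A) es w = w"
    and "es \<noteq> ds \<Longrightarrow> 0 \<in> set (map2 (component A) es w)"
proof -
  note len = hom_word_length[OF assms(1)]
  have nth: "map2 (component A) es w ! i = (if es ! i = ds ! i then w ! i else 0)"
    if "i < length w" for i
    using that assms len by (simp add: component_homogeneous[OF hom_word_nth])
  show "map2 (component A) es w = w" if "es = ds"
    using that len nth by (intro nth_equalityI) (simp_all del: nth_map)
  show "0 \<in> set (map2 (component A) es w)" if ne: "es \<noteq> ds"
  proof -
    obtain i where "i < length w" "es ! i \<noteq> ds ! i"
      using ne assms(2) len by (auto simp: list_eq_iff_nth_eq)
    then show ?thesis
      using nth[of i] assms(2) nth_mem[of i "map2 (component A) es w"] by (simp del: nth_map)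
  qed
qed

text \<open>The predicate constrains degree lists rather than words, so that it expresses both a fixed length
and a fixed total degree. The degrees of a word are not unique, since 0 has every degree; hence the
existential quantifier.\<close>

definition homog :: "(bit list \<Rightarrow> bool) \<Rightarrow> 'a formal \<Rightarrow> bool" where
  "homog D s \<longleftrightarrow> (\<forall>w\<in>Poly_Mapping.keys s. \<exists>ds. hom_word ds w \<and> D ds)"

lemma homog_zero [simp]: "homog D 0"
  by (simp add: homog_def)

lemma homog_of: "hom_word ds w \<Longrightarrow> D ds \<Longrightarrow> homog D (frag_of w)"
  by (auto simp: homog_def)

lemma homog_add: "homog D s \<Longrightarrow> homog D t \<Longrightarrow> homog D (s + t)"
  using keys_add[of s t] by (auto simp: homog_def)

lemma homog_diff: "homog D s \<Longrightarrow> homog D t \<Longrightarrow> homog D (s - t)"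
  using keys_diff[of s t] by (auto simp: homog_def)

lemma homog_mono: "homog D s \<Longrightarrow> (\<And>ds. D ds \<Longrightarrow> E ds) \<Longrightarrow> homog E s"
  by (auto simp: homog_def)

lemma homog_induct [consumes 1, case_names zero word diff]:
  assumes "homog D s" and "P 0" and "\<And>ds w. hom_word ds w \<Longrightarrow> D ds \<Longrightarrow> P (frag_of w)"
    and "\<And>s t. P s \<Longrightarrow> P t \<Longrightarrow> P (s - t)"
  shows "P s"
proof (rule frag_induction[of s "{w. \<exists>ds. hom_word ds w \<and> D ds}"])
  show "Poly_Mapping.keys s \<subseteq> {w. \<exists>ds. hom_word ds w \<and> D ds}"
    using assms(1) by (auto simp: homog_def)
qed (use assms in auto)

lemma teq_slot_add: "frag_of (xs @ [a + b] @ ys) \<simeq> frag_of (xs @ [a] @ ys) + frag_of (xs @ [b] @ ys)"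
  using tnull.additive[of xs a b ys A] by (simp add: teq_def diff_diff_eq)

lemma teq_slot_smult:
  "frag_of (xs @ [smult A k a] @ ys @ [b] @ zs) \<simeq> frag_of (xs @ [a] @ ys @ [smult A k b] @ zs)"
  using tnull.balanced by (auto simp: teq_def)

text \<open>The letters are split into their even and odd components one after the other, from left to right;
the prefix \<open>us\<close> in the induction consists of the letters that are already homogeneous.\<close>

lemma homogeneous_representative:
  assumes "\<forall>w\<in>Poly_Mapping.keys s. length w = n"
  shows "\<exists>s'. s \<simeq> s' \<and> homog (\<lambda>ds. length ds = n) s'"
proof -
  have word: "\<exists>s'. frag_of (us @ w) \<simeq> s' \<and> homog (\<lambda>ds. length ds = length (us @ w)) s'"
    if "hom_word es us" for es us w
    using that
  proof (induction w arbitrary: es us)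
    case Nil
    then show ?case
      by (auto intro!: exI[of _ "frag_of us"] homog_of hom_word_length)
  next
    case (Cons x w)
    let ?x = "\<lambda>d. component A d x"
    have "hom_word (es @ [d]) (us @ [?x d])" for d
      using Cons.prems by (auto simp: hom_word_append hom_word_length)
    from Cons.IH[OF this] obtain t where
      t: "frag_of ((us @ [?x d]) @ w) \<simeq> t d"
         "homog (\<lambda>ds. length ds = length ((us @ [?x d]) @ w)) (t d)" for d
      by metis
    have "frag_of (us @ x # w) = frag_of (us @ [?x 0 + ?x 1] @ w)"
      by (simp add: component_sum)
    also have "\<dots> \<simeq> frag_of (us @ [?x 0] @ w) + frag_of (us @ [?x 1] @ w)"
      by (rule teq_slot_add)
    also have "\<dots> \<simeq> t 0 + t 1"
      using t(1)[of 0] t(1)[of 1] by (intro teq_add) simp_all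
    finally have "frag_of (us @ x # w) \<simeq> t 0 + t 1" .
    moreover have "homog (\<lambda>ds. length ds = length (us @ x # w)) (t 0 + t 1)"
      using t(2)[of 0] t(2)[of 1] by (intro homog_add) simp_all
    ultimately show ?case
      by blast
  qed
  have "Poly_Mapping.keys s \<subseteq> {w. length w = n}"
    using assms by auto
  then show ?thesis
  proof (induction s rule: frag_induction)
    case zero
    show ?case by (intro exI[of _ 0]) simp
  next
    case (one w)
    then show ?case using word[of "[]" "[]" w] by simp
  next
    case (diff s t)
    then show ?case by (meson teq_diff homog_diff)
  qed
qed

section \<open>Products of formal tensors\<close>

text \<open>Applying a linear map \<open>h c\<close> in each slot, with a parameter \<open>c\<close> that depends on the slot,
respects the tensor relations. Taking components, and multiplying by the letters of a fixed word
from either side, are of this form.\<close>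

lemma teq_map2:
  fixes h :: "'c \<Rightarrow> 'a \<Rightarrow> 'a"
  assumes add: "\<And>c a b. h c (a + b) = h c a + h c b"
    and smult: "\<And>c k a. h c (smult A k a) = smult A k (h c a)"
  shows "length cs = length (xs @ [a] @ ys) \<Longrightarrow> frag_of (map2 h cs (xs @ [a + b] @ ys))
      \<simeq> frag_of (map2 h cs (xs @ [a] @ ys)) + frag_of (map2 h cs (xs @ [b] @ ys))"
    and "length cs = length (xs @ [a] @ ys @ [b] @ zs) \<Longrightarrow>
      frag_of (map2 h cs (xs @ [smult A k a] @ ys @ [b] @ zs))
      \<simeq> frag_of (map2 h cs (xs @ [a] @ ys @ [smult A k b] @ zs))"
proof -
  have split: "\<exists>us c vs. cs = us @ [c] @ vs \<and> length us = m \<and> length vs = n"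
    if "length cs = m + Suc n" for cs :: "'c list" and m n
    using that
    by (intro exI[of _ "take m cs"] exI[of _ "cs ! m"] exI[of _ "drop (Suc m) cs"])
      (auto simp: id_take_nth_drop)
  show "frag_of (map2 h cs (xs @ [a + b] @ ys))
      \<simeq> frag_of (map2 h cs (xs @ [a] @ ys)) + frag_of (map2 h cs (xs @ [b] @ ys))"
    if "length cs = length (xs @ [a] @ ys)"
  proof -
    have "length cs = length xs + Suc (length ys)"
      using that by simp
    then obtain us c vs where cs: "cs = us @ [c] @ vs" "length us = length xs" "length vs = length ys"
      using split by blast
    show ?thesis
      using teq_slot_add[of "map2 h us xs" "h c a" "h c b" "map2 h vs ys"] by (simp add: cs add)
  qed
  show "frag_of (map2 h cs (xs @ [smult A k a] @ ys @ [b] @ zs))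
      \<simeq> frag_of (map2 h cs (xs @ [a] @ ys @ [smult A k b] @ zs))"
    if len: "length cs = length (xs @ [a] @ ys @ [b] @ zs)"
  proof -
    have "length cs = length xs + Suc (length ys + Suc (length zs))"
      using that by simp
    then obtain us c cs' where cs: "cs = us @ [c] @ cs'" "length us = length xs"
        "length cs' = length ys + Suc (length zs)"
      using split by blast
    obtain vs d ws where cs': "cs' = vs @ [d] @ ws" "length vs = length ys" "length ws = length zs"
      using split[OF cs(3)] by blast
    show ?thesis
      using teq_slot_smult[of "map2 h us xs" k "h c a" "map2 h vs ys" "h d b" "map2 h ws zs"]
      by (simp add: cs(1,2) cs' smult)
  qed
qed

definition fmult :: "'a formal \<Rightarrow> 'a formal \<Rightarrow> 'a formal" where
  "fmult s t = frag_extend (\<lambda>xs. frag_extend (word_mult A xs) t) s"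

lemma fmult_simps [simp]:
  "fmult 0 t = 0" "fmult s 0 = 0" "fmult (frag_of xs) (frag_of ys) = word_mult A xs ys"
  by (auto simp: fmult_def frag_extend_eq_0)

lemma fmult_diff_left: "fmult (s - s') t = fmult s t - fmult s' t"
  by (simp add: fmult_def frag_extend_diff)

lemma fmult_diff_right: "fmult s (t - t') = fmult s t - fmult s t'"
  unfolding fmult_def frag_extend_diff
  by (simp add: frag_extend_def frag_cmul_diff_right sum_subtractf)

lemma fmult_cmul_left: "fmult (frag_cmul k s) t = frag_cmul k (fmult s t)"
  by (simp add: fmult_def frag_extend_cmul)

lemma fmult_cmul_right: "fmult s (frag_cmul k t) = frag_cmul k (fmult s t)"
  unfolding fmult_def frag_extend_cmul
  by (simp add: frag_extend_def frag_cmul_sum mult_ac)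

lemma fmult_swap: "fmult s t = frag_extend (\<lambda>ys. frag_extend (\<lambda>xs. word_mult A xs ys) s) t"
  using subset_UNIV
proof (induction t rule: frag_induction)
  case (one ys)
  show ?case by (simp add: fmult_def)
qed (simp_all add: fmult_diff_right frag_extend_diff)

lemma word_mult_teq_left:
  assumes "s \<simeq> t"
  shows "frag_extend (\<lambda>xs. word_mult A xs ys) s \<simeq> frag_extend (\<lambda>xs. word_mult A xs ys) t"
proof (rule teq_frag_extend[OF _ _ assms])
  define h where "h c x = component A (fst c) x * snd c" for c x
  define W where "W ds es xs = map2 (*) (map2 (component A) ds xs) (map2 (component A) es ys)" for ds es xs
  have W: "W ds es xs = map2 h (zip ds (map2 (component A) es ys)) xs" for ds es xs
    unfolding W_def h_def by (rule nth_equalityI) auto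
  note h = teq_map2[of h, unfolded h_def, simplified component_add component_smult
      distrib_right smult_mult_left, OF refl refl, folded h_def]
  show "word_mult A (xs @ [a + b] @ zs) ys \<simeq> word_mult A (xs @ [a] @ zs) ys + word_mult A (xs @ [b] @ zs) ys"
    for xs a b zs
  proof (cases "length (xs @ [a] @ zs) = length ys")
    case True
    then show ?thesis
      unfolding word_mult_def W_def[symmetric]
      by (auto simp: W simp flip: sum.distrib frag_cmul_distrib2 intro!: teq_sum teq_cmul h[simplified])
  qed (simp add: word_mult_def)
  show "word_mult A (xs @ [smult A k a] @ us @ [b] @ zs) ys
      \<simeq> word_mult A (xs @ [a] @ us @ [smult A k b] @ zs) ys"
    for xs k a us b zs
  proof (cases "length (xs @ [a] @ us @ [b] @ zs) = length ys")
    case True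
    then show ?thesis
      unfolding word_mult_def W_def[symmetric]
      by (auto simp: W intro!: teq_sum teq_cmul h[simplified])
  qed (simp add: word_mult_def)
qed

lemma word_mult_teq_right:
  assumes "s \<simeq> t"
  shows "frag_extend (word_mult A xs) s \<simeq> frag_extend (word_mult A xs) t"
proof (rule teq_frag_extend[OF _ _ assms])
  define h where "h c x = snd c * component A (fst c) x" for c x
  define W where "W ds es ys = map2 (*) (map2 (component A) ds xs) (map2 (component A) es ys)" for ds es ys
  have W: "W ds es ys = map2 h (zip es (map2 (component A) ds xs)) ys" for ds es ys
    unfolding W_def h_def by (rule nth_equalityI) auto
  note h = teq_map2[of h, unfolded h_def, simplified component_add component_smult
      distrib_left smult_mult_right, OF refl refl, folded h_def]
  show "word_mult A xs (ys @ [a + b] @ zs) \<simeq> word_mult A xs (ys @ [a] @ zs) + word_mult A xs (ys @ [b] @ zs)"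
    for ys a b zs
  proof (cases "length (ys @ [a] @ zs) = length xs")
    case True
    then show ?thesis
      unfolding word_mult_def W_def[symmetric]
      by (auto simp: W simp flip: sum.distrib frag_cmul_distrib2 intro!: teq_sum teq_cmul h[simplified])
  qed (simp add: word_mult_def)
  show "word_mult A xs (ys @ [smult A k a] @ us @ [b] @ zs)
      \<simeq> word_mult A xs (ys @ [a] @ us @ [smult A k b] @ zs)"
    for ys k a us b zs
  proof (cases "length (ys @ [a] @ us @ [b] @ zs) = length xs")
    case True
    then show ?thesis
      unfolding word_mult_def W_def[symmetric]
      by (auto simp: W intro!: teq_sum teq_cmul h[simplified])
  qed (simp add: word_mult_def)
qed

lemma fmult_teq:
  assumes "s \<simeq> s'" "t \<simeq> t'" shows "fmult s t \<simeq> fmult s' t'"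
proof -
  have "fmult s t \<simeq> fmult s t'"
    unfolding fmult_def by (intro teq_frag_extend_pointwise word_mult_teq_right assms)
  also have "fmult s t' \<simeq> fmult s' t'"
    unfolding fmult_swap by (intro teq_frag_extend_pointwise word_mult_teq_left assms)
  finally show ?thesis .
qed

text \<open>On homogeneous words the double sum that defines the product collapses to the familiar graded
product of pure tensors.\<close>

lemma word_mult_homogeneous:
  assumes "hom_word ds xs" "hom_word es ys" "length xs = length ys"
  shows "word_mult A xs ys \<simeq> frag_cmul (sign (koszul ds es)) (frag_of (map2 (*) xs ys))"
proof -
  let ?L = "{ds :: bit list. length ds = length xs}"
  let ?R = "frag_cmul (sign (koszul ds es)) (frag_of (map2 (*) xs ys))"
  have zero: "0 \<in> set (map2 (*) u v)" if len: "length u = length v" and uv: "0 \<in> set u \<or> 0 \<in> set v"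
    for u v :: "'a list"
  proof -
    obtain i where i: "i < length u" "u ! i = 0 \<or> v ! i = 0"
      using uv len unfolding in_set_conv_nth by auto
    then have "map2 (*) u v ! i = 0" "i < length (map2 (*) u v)"
      using len by auto
    then show ?thesis
      by (metis nth_mem)
  qed
  have "word_mult A xs ys = (\<Sum>ds'\<in>?L. \<Sum>es'\<in>?L. frag_cmul (sign (koszul ds' es'))
          (frag_of (map2 (*) (map2 (component A) ds' xs) (map2 (component A) es' ys))))"
    using assms(3) by (simp add: word_mult_def)
  also have "\<dots> \<simeq> (\<Sum>ds'\<in>?L. \<Sum>es'\<in>?L. if ds' = ds \<and> es' = es then ?R else 0)"
  proof (intro teq_sum)
    fix ds' es' assume L: "ds' \<in> ?L" "es' \<in> ?L"
    let ?x = "map2 (component A) ds' xs" and ?y = "map2 (component A) es' ys"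
    show "frag_cmul (sign (koszul ds' es')) (frag_of (map2 (*) ?x ?y))
        \<simeq> (if ds' = ds \<and> es' = es then ?R else 0)"
    proof (cases "ds' = ds \<and> es' = es")
      case True
      then show ?thesis
        using map2_component(1)[OF assms(1), of ds'] map2_component(1)[OF assms(2), of es'] L assms(3)
        by simp
    next
      case False
      have "0 \<in> set (map2 (*) ?x ?y)"
      proof (rule zero)
        show "0 \<in> set ?x \<or> 0 \<in> set ?y"
          using False map2_component(2)[OF assms(1), of ds'] map2_component(2)[OF assms(2), of es'] L assms(3)
          by auto
      qed (use L assms(3) in simp)
      from teq_cmul[OF teq_zero_letter[OF this]] show ?thesis
        unfolding if_not_P[OF False] frag_cmul_zero2 .
    qed
  qed
  also have "\<dots> = (\<Sum>ds'\<in>?L. if ds' = ds then (\<Sum>es'\<in>?L. if es' = es then ?R else 0) else 0)"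
    by (intro sum.cong) auto
  also have "\<dots> = ?R"
    using assms by (simp add: hom_word_length)
  finally show ?thesis .
qed

lemma koszul_add_left:
  assumes "length ds' = length ds"
  shows "koszul (map2 (+) ds ds') es = koszul ds es + koszul ds' es"
  unfolding koszul_def assms sum.distrib[symmetric]
  using assms by (intro sum.cong) (auto simp: distrib_right)

lemma koszul_add_right:
  assumes "length es = length ds" "length es' = length ds"
  shows "koszul ds (map2 (+) es es') = koszul ds es + koszul ds es'"
  unfolding koszul_def sum.distrib[symmetric]
  using assms by (intro sum.cong) (auto simp: distrib_left)

lemma fmult_keys_length:
  assumes "\<And>w. w \<in> Poly_Mapping.keys t \<Longrightarrow> length w = n" "v \<in> Poly_Mapping.keys (fmult s t)"
  shows "length v = n"
proof -
  obtain xs ys where xy: "ys \<in> Poly_Mapping.keys t" "v \<in> Poly_Mapping.keys (word_mult A xs ys)"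
    using assms(2) unfolding fmult_def by (auto elim!: keys_frag_extendE)
  have "length v = length ys"
    using xy(2) unfolding word_mult_def
    by (auto split: if_splits dest!: subsetD[OF keys_sum])
  then show ?thesis
    using assms(1) xy(1) by simp
qed

text \<open>On homogeneous words both sides are the same word of threefold products. The signs agree because
\<open>koszul\<close> is biadditive: both are given by
\<open>koszul ds es + koszul ds fs + koszul es fs\<close>.\<close>

lemma fmult_assoc:
  assumes "homog (\<lambda>ds. length ds = n) s" "homog (\<lambda>ds. length ds = n) t" "homog (\<lambda>ds. length ds = n) u"
  shows "fmult (fmult s t) u \<simeq> fmult s (fmult t u)"
  using assms(1)
proof (induction rule: homog_induct)
  case s: (word ds xs)
  show ?case using assms(2)
  proof (induction rule: homog_induct)
    case t: (word es ys)
    show ?case using assms(3)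
    proof (induction rule: homog_induct)
      case u: (word fs zs)
      note len = hom_word_length[OF s(1)] hom_word_length[OF t(1)] hom_word_length[OF u(1)] s(2) t(2) u(2)
      have xy: "hom_word (map2 (+) ds es) (map2 (*) xs ys)" and yz: "hom_word (map2 (+) es fs) (map2 (*) ys zs)"
        by (intro hom_word_mult s t u)+
      have st: "word_mult A xs ys \<simeq> frag_cmul (sign (koszul ds es)) (frag_of (map2 (*) xs ys))"
        using len by (intro word_mult_homogeneous s t) simp
      have tu: "word_mult A ys zs \<simeq> frag_cmul (sign (koszul es fs)) (frag_of (map2 (*) ys zs))"
        using len by (intro word_mult_homogeneous t u) simp
      have "fmult (fmult (frag_of xs) (frag_of ys)) (frag_of zs)
          \<simeq> fmult (frag_cmul (sign (koszul ds es)) (frag_of (map2 (*) xs ys))) (frag_of zs)"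
        unfolding fmult_simps by (rule fmult_teq[OF st teq_refl])
      also have "\<dots> \<simeq> frag_cmul (sign (koszul ds es)) (frag_cmul (sign (koszul (map2 (+) ds es) fs))
            (frag_of (map2 (*) (map2 (*) xs ys) zs)))"
        unfolding fmult_cmul_left fmult_simps
        using len by (intro teq_cmul word_mult_homogeneous xy u) simp
      also have "\<dots> = frag_cmul (sign (koszul es fs)) (frag_cmul (sign (koszul ds (map2 (+) es fs)))
            (frag_of (map2 (*) xs (map2 (*) ys zs))))"
      proof -
        have "map2 (*) (map2 (*) xs ys) zs = map2 (*) xs (map2 (*) ys zs)"
          using len by (intro nth_equalityI) (auto simp: mult.assoc)
        then show ?thesis
          using len by (simp add: koszul_add_left koszul_add_right sign_add mult_ac)
      qed
      also have "\<dots> \<simeq> fmult (frag_of xs) (frag_cmul (sign (koszul es fs)) (frag_of (map2 (*) ys zs)))"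
        unfolding fmult_cmul_right fmult_simps
        using len by (intro teq_cmul teq_sym[OF word_mult_homogeneous] yz s) simp
      also have "\<dots> \<simeq> fmult (frag_of xs) (fmult (frag_of ys) (frag_of zs))"
        unfolding fmult_simps by (rule fmult_teq[OF teq_refl teq_sym[OF tu]])
      finally show ?case .
    qed (simp_all add: fmult_diff_left fmult_diff_right teq_diff)
  qed (simp_all add: fmult_diff_left fmult_diff_right teq_diff)
qed (simp_all add: fmult_diff_left fmult_diff_right teq_diff)

lemma fmult_one_left:
  assumes "homog (\<lambda>ds. length ds = n) s"
  shows "fmult (frag_of (replicate n 1)) s \<simeq> s"
  using assms
proof (induction rule: homog_induct)
  case (word ds w)
  have "koszul (replicate n 0) ds = 0"
    by (simp add: koszul_def)
  moreover have "map2 (*) (replicate n 1) w = w"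
    using word by (intro nth_equalityI) (auto dest: hom_word_length)
  ultimately show ?case
    using word_mult_homogeneous[OF hom_word_replicate_one word(1), of n] word
    by (simp add: hom_word_length)
qed (simp_all add: fmult_diff_right teq_diff)

lemma fmult_one_right:
  assumes "homog (\<lambda>ds. length ds = n) s"
  shows "fmult s (frag_of (replicate n 1)) \<simeq> s"
  using assms
proof (induction rule: homog_induct)
  case (word ds w)
  have "koszul ds (replicate n 0) = 0"
    using word by (simp add: koszul_def)
  moreover have "map2 (*) w (replicate n 1) = w"
    using word by (intro nth_equalityI) (auto dest: hom_word_length)
  ultimately show ?case
    using word_mult_homogeneous[OF word(1) hom_word_replicate_one, of n] word
    by (simp add: hom_word_length)
qed (simp_all add: fmult_diff_left teq_diff)

section \<open>The monoid of tensors of fixed length\<close>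

lemma tmult_tclass: "tclass A s \<odot> tclass A t = tclass A (fmult s t)"
  by (simp add: tmult_def tclass_eq_iff fmult_teq rep_tclass flip: fmult_def)

lemma tpower_iff: "X \<in> tpower A n \<longleftrightarrow> (\<exists>s. X = tclass A s \<and> homog (\<lambda>ds. length ds = n) s)"
proof
  assume "X \<in> tpower A n"
  then obtain s where "X = tclass A s" "\<forall>w\<in>Poly_Mapping.keys s. length w = n"
    by (auto simp: tpower_def)
  then show "\<exists>s. X = tclass A s \<and> homog (\<lambda>ds. length ds = n) s"
    using homogeneous_representative[of s n] tclass_eq_iff by auto
next
  assume "\<exists>s. X = tclass A s \<and> homog (\<lambda>ds. length ds = n) s"
  then show "X \<in> tpower A n"
    unfolding tpower_def homog_def using hom_word_length by fastforce
qed

lemma tgrade_iff: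
  "X \<in> tgrade A n d \<longleftrightarrow> (\<exists>s. X = tclass A s \<and> homog (\<lambda>ds. length ds = n \<and> sum_list ds = d) s)"
proof -
  have "length w = n \<and> (\<exists>ds. hom_word ds w \<and> sum_list ds = d)
      \<longleftrightarrow> (\<exists>ds. hom_word ds w \<and> length ds = n \<and> sum_list ds = d)" for w
    by (auto dest: hom_word_length)
  then show ?thesis
    unfolding tgrade_def homog_def hom_word_def[symmetric] by simp
qed

lemma tgrade_tpower: "X \<in> tgrade A n d \<Longrightarrow> X \<in> tpower A n"
  unfolding tgrade_iff tpower_iff
  by (elim exE conjE, intro exI conjI, assumption, erule homog_mono, simp)

lemma tone_tpower: "tone A n \<in> tpower A n"
  unfolding tone_def pure_def tpower_iff
  using homog_of[OF hom_word_replicate_one[of n], of "\<lambda>ds. length ds = n"] by auto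

lemma tpower_diff:
  assumes "tclass A s \<in> tpower A n" "tclass A t \<in> tpower A n"
  shows "tclass A (s - t) \<in> tpower A n"
proof -
  obtain s' t' where "s \<simeq> s'" "t \<simeq> t'" and hom: "homog (\<lambda>ds. length ds = n) s'" "homog (\<lambda>ds. length ds = n) t'"
    using assms by (auto simp: tpower_iff tclass_eq_iff)
  then have "tclass A (s - t) = tclass A (s' - t')"
    by (simp add: tclass_eq_iff teq_diff)
  then show ?thesis
    unfolding tpower_iff using homog_diff[OF hom] by blast
qed

lemma tmult_tpower:
  assumes "X \<in> tpower A n" "Y \<in> tpower A n" shows "X \<odot> Y \<in> tpower A n"
proof -
  obtain s t where st: "X = tclass A s" "Y = tclass A t" "\<forall>w\<in>Poly_Mapping.keys t. length w = n"
    using assms by (auto simp: tpower_def)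
  then have "\<forall>w\<in>Poly_Mapping.keys (fmult s t). length w = n"
    using fmult_keys_length by blast
  then show ?thesis
    unfolding st tmult_tclass by (auto simp: tpower_def)
qed

lemma tmult_assoc:
  assumes "X \<in> tpower A n" "Y \<in> tpower A n" "Z \<in> tpower A n"
  shows "X \<odot> Y \<odot> Z = X \<odot> (Y \<odot> Z)"
  using assms unfolding tpower_iff
  by (elim exE conjE) (simp add: tmult_tclass tclass_eq_iff fmult_assoc)

lemma tone_tmult: "X \<in> tpower A n \<Longrightarrow> tone A n \<odot> X = X"
  unfolding tpower_iff tone_def pure_def
  by (elim exE conjE) (simp add: tmult_tclass tclass_eq_iff fmult_one_left del: fmult_simps)

lemma tmult_tone: "X \<in> tpower A n \<Longrightarrow> X \<odot> tone A n = X"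
  unfolding tpower_iff tone_def pure_def
  by (elim exE conjE) (simp add: tmult_tclass tclass_eq_iff fmult_one_right del: fmult_simps)

lemma tinverse_unique:
  assumes "X \<in> tpower A n" "is_tinverse A n X Y" "Z \<in> tpower A n" "X \<odot> Z = tone A n"
  shows "Z = Y"
proof -
  have Y: "Y \<in> tpower A n" "Y \<odot> X = tone A n"
    using assms(2) by (auto simp: is_tinverse_def)
  have "Z = (Y \<odot> X) \<odot> Z"
    by (simp add: Y tone_tmult assms)
  also have "\<dots> = Y \<odot> (X \<odot> Z)"
    by (rule tmult_assoc) (use Y assms in auto)
  also have "\<dots> = Y"
    by (simp add: Y tmult_tone assms)
  finally show ?thesis .
qed

lemma tinverse_is_tinverse:
  assumes "tinvertible A n X" shows "is_tinverse A n X (tinverse A n X)"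
proof -
  obtain Y where X: "X \<in> tpower A n" and Y: "is_tinverse A n X Y"
    using assms by (auto simp: tinvertible_def)
  have "Z = Y" if "is_tinverse A n X Z" for Z
    using tinverse_unique[OF X Y] that by (simp add: is_tinverse_def)
  with Y show ?thesis
    unfolding tinverse_def by (rule theI)
qed

section \<open>The inverse of an even tensor\<close>

text \<open>The projection of a tensor to total degree 0 along total degree 1, computed on words by expanding
each letter into its components.\<close>

definition even_part :: "'a formal \<Rightarrow> 'a formal" where
  "even_part = frag_extend (\<lambda>w. \<Sum>ds | length ds = length w \<and> sum_list ds = 0.
     frag_of (map2 (component A) ds w))"

lemma even_part_simps:
  "even_part 0 = 0" "even_part (s - t) = even_part s - even_part t"
  "even_part (frag_cmul k s) = frag_cmul k (even_part s)"
  by (simp_all add: even_part_def frag_extend_diff frag_extend_cmul)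

lemma even_part_teq:
  assumes "s \<simeq> t" shows "even_part s \<simeq> even_part t"
  unfolding even_part_def
proof (rule teq_frag_extend[OF _ _ assms])
  note comp = teq_map2[of "component A", OF component_add component_smult]
  show "(\<Sum>ds | length ds = length (xs @ [a + b] @ ys) \<and> sum_list ds = 0.
            frag_of (map2 (component A) ds (xs @ [a + b] @ ys)))
        \<simeq> (\<Sum>ds | length ds = length (xs @ [a] @ ys) \<and> sum_list ds = 0.
              frag_of (map2 (component A) ds (xs @ [a] @ ys))) +
          (\<Sum>ds | length ds = length (xs @ [b] @ ys) \<and> sum_list ds = 0.
              frag_of (map2 (component A) ds (xs @ [b] @ ys)))" for xs a b ys
    by (auto simp flip: sum.distrib intro!: teq_sum comp[simplified])
  show "(\<Sum>ds | length ds = length (xs @ [smult A k a] @ ys @ [b] @ zs) \<and> sum_list ds = 0.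
            frag_of (map2 (component A) ds (xs @ [smult A k a] @ ys @ [b] @ zs)))
        \<simeq> (\<Sum>ds | length ds = length (xs @ [a] @ ys @ [smult A k b] @ zs) \<and> sum_list ds = 0.
              frag_of (map2 (component A) ds (xs @ [a] @ ys @ [smult A k b] @ zs)))"
    for xs k a ys b zs
    by (auto intro!: teq_sum comp[simplified])
qed

lemma homog_sum: "(\<And>i. i \<in> I \<Longrightarrow> homog D (f i)) \<Longrightarrow> homog D (sum f I)"
  by (induction I rule: infinite_finite_induct) (auto intro: homog_add)

lemma even_part_homog:
  assumes "homog (\<lambda>ds. length ds = n) s"
  shows "homog (\<lambda>ds. length ds = n \<and> sum_list ds = 0) (even_part s)"
  using assms
proof (induction rule: homog_induct)
  case (word ds w)
  have "length w = n"
    using word by (simp add: hom_word_length)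
  then show ?case
    by (auto simp: even_part_def intro!: homog_sum homog_of hom_word_component)
qed (simp_all add: even_part_simps homog_diff)

lemma even_part_word:
  assumes "hom_word ds w"
  shows "even_part (frag_of w) \<simeq> (if sum_list ds = 0 then frag_of w else 0)"
proof -
  let ?L = "{es :: bit list. length es = length w \<and> sum_list es = 0}"
  have fin: "finite ?L"
    by (rule finite_subset[OF _ finite_bit_lists[of "length w"]]) auto
  have "even_part (frag_of w) \<simeq> (\<Sum>es\<in>?L. if es = ds then frag_of w else 0)"
    unfolding even_part_def frag_extend_of
  proof (rule teq_sum)
    fix es assume es: "es \<in> ?L"
    show "frag_of (map2 (component A) es w) \<simeq> (if es = ds then frag_of w else 0)"
    proof (cases "es = ds")
      case True
      then show ?thesis
        using map2_component(1)[OF assms, of es] es by simp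
    next
      case False
      then show ?thesis
        using teq_zero_letter[OF map2_component(2)[OF assms, of es]] es by simp
    qed
  qed
  also have "\<dots> = (if sum_list ds = 0 then frag_of w else 0)"
    using fin by (simp add: sum.delta hom_word_length[OF assms])
  finally show ?thesis .
qed

lemma sum_list_map2_add:
  "length ds = length es \<Longrightarrow> sum_list (map2 (+) ds es) = sum_list ds + sum_list (es :: bit list)"
  by (induction ds es rule: list_induct2) (simp_all add: ac_simps)

text \<open>Multiplication by an even element preserves total degree, hence commutes with the projection.\<close>

lemma even_part_fmult:
  assumes "homog (\<lambda>ds. length ds = n \<and> sum_list ds = 0) s" "homog (\<lambda>ds. length ds = n) t"
  shows "even_part (fmult s t) \<simeq> fmult s (even_part t)"
  using assms(1)
proof (induction rule: homog_induct)
  case s: (word ds xs)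
  show ?case using assms(2)
  proof (induction rule: homog_induct)
    case t: (word es ys)
    have len: "length xs = length ys" "length ds = length es"
      using s t by (simp_all add: hom_word_length[symmetric])
    let ?k = "frag_cmul (sign (koszul ds es))" and ?xy = "frag_of (map2 (*) xs ys)"
    note st = word_mult_homogeneous[OF s(1) t(1) len(1)]
    have "even_part (fmult (frag_of xs) (frag_of ys)) \<simeq> even_part (?k ?xy)"
      unfolding fmult_simps by (rule even_part_teq[OF st])
    also have "\<dots> \<simeq> ?k (if sum_list es = 0 then ?xy else 0)"
      unfolding even_part_simps
      using teq_cmul[OF even_part_word[OF hom_word_mult[OF s(1) t(1)]]] s(2) len
      by (simp add: sum_list_map2_add)
    also have "\<dots> \<simeq> fmult (frag_of xs) (if sum_list es = 0 then frag_of ys else 0)"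
      using teq_sym[OF st] by simp
    also have "\<dots> \<simeq> fmult (frag_of xs) (even_part (frag_of ys))"
      by (rule fmult_teq[OF teq_refl teq_sym[OF even_part_word[OF t(1)]]])
    finally show ?case .
  qed (simp_all add: fmult_diff_right even_part_simps teq_diff)
qed (simp_all add: fmult_diff_left even_part_simps teq_diff)

text \<open>If \<open>X\<close> is even, the even part of \<open>1 = X Y\<close> is \<open>1 = X Y\<^sub>0\<close>, so \<open>Y\<^sub>0 = Y\<close> by uniqueness of inverses.\<close>

lemma tinverse_even:
  assumes "X \<in> tgrade A n 0" "is_tinverse A n X Y"
  shows "Y \<in> tgrade A n 0"
proof -
  obtain s where s: "X = tclass A s" "homog (\<lambda>ds. length ds = n \<and> sum_list ds = 0) s"
    using assms(1) by (auto simp: tgrade_iff)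
  have "Y \<in> tpower A n" and XY: "X \<odot> Y = tone A n"
    using assms(2) by (auto simp: is_tinverse_def)
  then obtain t where t: "Y = tclass A t" "homog (\<lambda>ds. length ds = n) t"
    by (auto simp: tpower_iff)
  let ?one = "frag_of (replicate n 1)"
  have "fmult s (even_part t) \<simeq> even_part (fmult s t)"
    by (rule teq_sym[OF even_part_fmult[OF s(2) t(2)]])
  also have "\<dots> \<simeq> even_part ?one"
    using XY by (intro even_part_teq) (simp add: s(1) t(1) tmult_tclass tclass_eq_iff tone_def pure_def)
  also have "\<dots> \<simeq> ?one"
    using even_part_word[OF hom_word_replicate_one, of n] by (simp add: sum_list_replicate)
  finally have "X \<odot> tclass A (even_part t) = tone A n"
    by (simp add: s(1) tmult_tclass tclass_eq_iff tone_def pure_def)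
  moreover have even: "tclass A (even_part t) \<in> tgrade A n 0"
    unfolding tgrade_iff using even_part_homog[OF t(2)] by blast
  ultimately have "tclass A (even_part t) = Y"
    using tinverse_unique[OF tgrade_tpower[OF assms(1)] assms(2)] tgrade_tpower by blast
  then show ?thesis
    using even by simp
qed

section \<open>Tensor products with the unit\<close>

lemma juxtapose_simps [simp]:
  "juxtapose 0 t = 0" "juxtapose s 0 = 0" "juxtapose (frag_of xs) (frag_of ys) = frag_of (xs @ ys)"
  "juxtapose (frag_cmul k s) t = frag_cmul k (juxtapose s t)"
  "juxtapose (s - s') t = juxtapose s t - juxtapose s' t"
  by (auto simp: juxtapose_def frag_extend_eq_0 frag_extend_cmul frag_extend_diff)

lemma juxtapose_diff_right: "juxtapose s (t - t') = juxtapose s t - juxtapose s t'"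
  unfolding juxtapose_def frag_extend_diff
  by (simp add: frag_extend_def frag_cmul_diff_right sum_subtractf)

lemma juxtapose_cmul_right: "juxtapose s (frag_cmul k t) = frag_cmul k (juxtapose s t)"
  unfolding juxtapose_def frag_extend_cmul
  by (simp add: frag_extend_def frag_cmul_sum mult_ac)

lemma juxtapose_swap: "juxtapose s t = frag_extend (\<lambda>ys. frag_extend (\<lambda>xs. frag_of (xs @ ys)) s) t"
  using subset_UNIV
proof (induction t rule: frag_induction)
  case (one ys)
  show ?case by (simp add: juxtapose_def)
qed (simp_all add: juxtapose_diff_right frag_extend_diff)

lemma juxtapose_teq:
  assumes "s \<simeq> s'" "t \<simeq> t'" shows "juxtapose s t \<simeq> juxtapose s' t'"
proof -
  have "juxtapose s t \<simeq> juxtapose s t'"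
    unfolding juxtapose_def
  proof (intro teq_frag_extend_pointwise teq_frag_extend[OF _ _ assms(2)])
    show "frag_of (us @ xs @ [a + b] @ ys) \<simeq> frag_of (us @ xs @ [a] @ ys) + frag_of (us @ xs @ [b] @ ys)"
      for us xs a b ys using teq_slot_add[of "us @ xs"] by simp
    show "frag_of (us @ xs @ [smult A k a] @ ys @ [b] @ zs) \<simeq> frag_of (us @ xs @ [a] @ ys @ [smult A k b] @ zs)"
      for us xs a b ys zs k using teq_slot_smult[of "us @ xs"] by simp
  qed
  also have "juxtapose s t' \<simeq> juxtapose s' t'"
    unfolding juxtapose_swap
  proof (intro teq_frag_extend_pointwise teq_frag_extend[OF _ _ assms(1)])
    show "frag_of ((xs @ [a + b] @ ys) @ us) \<simeq> frag_of ((xs @ [a] @ ys) @ us) + frag_of ((xs @ [b] @ ys) @ us)"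
      for us xs a b ys using teq_slot_add[of xs a b "ys @ us"] by simp
    show "frag_of ((xs @ [smult A k a] @ ys @ [b] @ zs) @ us) \<simeq> frag_of ((xs @ [a] @ ys @ [smult A k b] @ zs) @ us)"
      for us xs a b ys zs k using teq_slot_smult[of xs k a ys b "zs @ us"] by simp
  qed
  finally show ?thesis .
qed

lemma tjoin_tclass: "tclass A s \<otimes> tclass A t = tclass A (juxtapose s t)"
  by (simp add: tjoin_def tclass_eq_iff juxtapose_teq rep_tclass)

lemma juxtapose_homog:
  assumes "homog D s" "homog E t"
    and "\<And>ds es. D ds \<Longrightarrow> E es \<Longrightarrow> C (ds @ es)"
  shows "homog C (juxtapose s t)"
  using assms(1)
proof (induction rule: homog_induct)
  case s: (word ds xs)
  show ?case using assms(2)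
  proof (induction rule: homog_induct)
    case (word es ys)
    then show ?case
      using s assms(3) by (auto intro!: homog_of[of "ds @ es"] simp: hom_word_append hom_word_length)
  qed (simp_all add: juxtapose_diff_right homog_diff)
qed (simp_all add: homog_diff)

lemma tjoin_tpower:
  "X \<in> tpower A m \<Longrightarrow> Y \<in> tpower A n \<Longrightarrow> X \<otimes> Y \<in> tpower A (m + n)"
  unfolding tpower_iff
  by (elim exE conjE, intro exI conjI, simp only: tjoin_tclass, erule (1) juxtapose_homog) simp

lemma koszul_snoc_zero:
  "length ds = length es \<Longrightarrow> koszul (ds @ [0]) (es @ [0]) = koszul ds es"
  by (auto simp: koszul_def nth_append intro!: sum.cong)

lemma koszul_Cons_zero: "koszul (0 # ds) (0 # es) = koszul ds es"
  by (simp add: koszul_def sum.lessThan_Suc_shift del: sum.lessThan_Suc)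

text \<open>The extra letter 1 has degree 0 and contributes nothing to the Koszul sign.\<close>

lemma tjoin_one_tmult:
  assumes "X \<in> tpower A n" "Y \<in> tpower A n"
  shows "(X \<otimes> pure A [1]) \<odot> (Y \<otimes> pure A [1]) = (X \<odot> Y) \<otimes> pure A [1]"
proof -
  let ?j = "\<lambda>s. juxtapose s (frag_of [1])"
  have "fmult (?j s) (?j t) \<simeq> ?j (fmult s t)"
    if st: "homog (\<lambda>ds. length ds = n) s" "homog (\<lambda>ds. length ds = n) t" for s t
    using st(1)
  proof (induction rule: homog_induct)
    case s: (word ds xs)
    show ?case using st(2)
    proof (induction rule: homog_induct)
      case t: (word es ys)
      have len: "length xs = length ys" "length ds = length es"
        using s t by (simp_all add: hom_word_length[symmetric])
      have "hom_word (ds @ [0]) (xs @ [1])" "hom_word (es @ [0]) (ys @ [1])"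
        using s t by (simp_all add: hom_word_append hom_word_length grade_one)
      note xy = word_mult_homogeneous[OF this]
      have "fmult (?j (frag_of xs)) (?j (frag_of ys))
          \<simeq> ?j (frag_cmul (sign (koszul ds es)) (frag_of (map2 (*) xs ys)))"
        using xy len by (simp add: koszul_snoc_zero)
      also have "\<dots> \<simeq> ?j (fmult (frag_of xs) (frag_of ys))"
        unfolding fmult_simps
        by (rule juxtapose_teq[OF teq_sym[OF word_mult_homogeneous[OF s(1) t(1) len(1)]] teq_refl])
      finally show ?case .
    qed (simp_all add: fmult_diff_right teq_diff)
  qed (simp_all add: fmult_diff_left teq_diff)
  then show ?thesis
    using assms unfolding tpower_iff pure_def
    by (elim exE conjE) (simp add: tjoin_tclass tmult_tclass tclass_eq_iff)
qed

lemma one_tjoin_tmult: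
  assumes "X \<in> tpower A n" "Y \<in> tpower A n"
  shows "(pure A [1] \<otimes> X) \<odot> (pure A [1] \<otimes> Y) = pure A [1] \<otimes> (X \<odot> Y)"
proof -
  let ?j = "\<lambda>s. juxtapose (frag_of [1]) s"
  have "fmult (?j s) (?j t) \<simeq> ?j (fmult s t)"
    if st: "homog (\<lambda>ds. length ds = n) s" "homog (\<lambda>ds. length ds = n) t" for s t
    using st(1)
  proof (induction rule: homog_induct)
    case s: (word ds xs)
    show ?case using st(2)
    proof (induction rule: homog_induct)
      case t: (word es ys)
      have len: "length xs = length ys" "length ds = length es"
        using s t by (simp_all add: hom_word_length[symmetric])
      have "hom_word (0 # ds) (1 # xs)" "hom_word (0 # es) (1 # ys)"
        using s t by (simp_all add: grade_one)
      note xy = word_mult_homogeneous[OF this]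
      have "fmult (?j (frag_of xs)) (?j (frag_of ys))
          \<simeq> ?j (frag_cmul (sign (koszul ds es)) (frag_of (map2 (*) xs ys)))"
        using xy len by (simp add: koszul_Cons_zero juxtapose_cmul_right)
      also have "\<dots> \<simeq> ?j (fmult (frag_of xs) (frag_of ys))"
        unfolding fmult_simps
        by (rule juxtapose_teq[OF teq_refl teq_sym[OF word_mult_homogeneous[OF s(1) t(1) len(1)]]])
      finally show ?case .
    qed (simp_all add: fmult_diff_right juxtapose_diff_right teq_diff)
  qed (simp_all add: fmult_diff_left juxtapose_diff_right teq_diff)
  then show ?thesis
    using assms unfolding tpower_iff pure_def
    by (elim exE conjE) (simp add: tjoin_tclass tmult_tclass tclass_eq_iff)
qed

section \<open>Contractions\<close>

definition multilinear :: "('a list \<Rightarrow> 'b::ring_1) \<Rightarrow> bool" where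
  "multilinear f \<longleftrightarrow>
     (\<forall>xs a b ys. f (xs @ [a + b] @ ys) = f (xs @ [a] @ ys) + f (xs @ [b] @ ys)) \<and>
     (\<forall>xs k a ys b zs. f (xs @ [smult A k a] @ ys @ [b] @ zs) = f (xs @ [a] @ ys @ [smult A k b] @ zs))"

lemma multilinear_feval_teq: "multilinear f \<Longrightarrow> s \<simeq> t \<Longrightarrow> feval f s = feval f t"
  unfolding multilinear_def by (rule feval_teq) blast+

lemma contract_tclass: "multilinear f \<Longrightarrow> contract f (tclass A s) = feval f s"
  by (simp add: contract_feval multilinear_feval_teq rep_tclass)

text \<open>The value 0 on words of other lengths is consistent with the relations, because each of them
involves words of one length only.\<close>

lemma multilinear_pair:
  fixes f :: "'a \<Rightarrow> 'a \<Rightarrow> 'b::ring_1"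
  assumes "\<And>a b y. f (a + b) y = f a y + f b y" "\<And>a b x. f x (a + b) = f x a + f x b"
    and "\<And>k a b. f (smult A k a) b = f a (smult A k b)"
  shows "multilinear (\<lambda>w. case w of [x, y] \<Rightarrow> f x y | _ \<Rightarrow> 0)"
proof -
  have "(case xs @ u # ys of [x, y] \<Rightarrow> f x y | _ \<Rightarrow> 0) =
      (case xs of [] \<Rightarrow> (case ys of [y] \<Rightarrow> f u y | _ \<Rightarrow> 0)
        | [x] \<Rightarrow> (case ys of [] \<Rightarrow> f x u | _ \<Rightarrow> 0) | _ \<Rightarrow> 0)" for xs u ys
    by (auto split: list.split)
  then show ?thesis
    unfolding multilinear_def by (auto simp: assms append_eq_Cons_conv split: list.split)
qed

lemma multilinear_triple:
  fixes f :: "'a \<Rightarrow> 'a \<Rightarrow> 'a \<Rightarrow> 'b::ring_1"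
  assumes "\<And>a b y z. f (a + b) y z = f a y z + f b y z" "\<And>a b x z. f x (a + b) z = f x a z + f x b z"
    and "\<And>a b x y. f x y (a + b) = f x y a + f x y b"
    and "\<And>k a b c. f (smult A k a) b c = f a (smult A k b) c"
    and "\<And>k a b c. f a (smult A k b) c = f a b (smult A k c)"
  shows "multilinear (\<lambda>w. case w of [x, y, z] \<Rightarrow> f x y z | _ \<Rightarrow> 0)"
proof -
  have "(case xs @ u # ys of [x, y, z] \<Rightarrow> f x y z | _ \<Rightarrow> 0) =
      (case xs of [] \<Rightarrow> (case ys of [y, z] \<Rightarrow> f u y z | _ \<Rightarrow> 0)
        | [x] \<Rightarrow> (case ys of [z] \<Rightarrow> f x u z | _ \<Rightarrow> 0)
        | [x, y] \<Rightarrow> (case ys of [] \<Rightarrow> f x y u | _ \<Rightarrow> 0) | _ \<Rightarrow> 0)" for xs u ys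
    by (auto split: list.split)
  then show ?thesis
    unfolding multilinear_def by (auto simp: assms append_eq_Cons_conv split: list.split)
qed

lemma feval_word_mult:
  assumes "multilinear f" "hom_word ds xs" "hom_word es ys" "length xs = length ys"
  shows "feval f (word_mult A xs ys) = of_int (sign (koszul ds es)) * f (map2 (*) xs ys)"
  using multilinear_feval_teq[OF assms(1) word_mult_homogeneous[OF assms(2-4)]]
  by (simp add: feval_cmul)

lemma hom_word_2E:
  assumes "hom_word ds w" "length ds = 2"
  obtains p q x y where "ds = [p, q]" "w = [x, y]" "x \<in> grade A p" "y \<in> grade A q"
proof -
  obtain p q where ds: "ds = [p, q]"
    using assms(2) by (auto simp: numeral_2_eq_2 length_Suc_conv)
  moreover obtain x y where "w = [x, y]"
    using assms(1) by (auto simp: ds hom_word_def list_all2_Cons1)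
  ultimately show thesis
    using that assms(1) by simp
qed

lemma hom_word_3E:
  assumes "hom_word ds w" "length ds = 3"
  obtains p q r x y z where "ds = [p, q, r]" "w = [x, y, z]"
    "x \<in> grade A p" "y \<in> grade A q" "z \<in> grade A r"
proof -
  obtain p q r where ds: "ds = [p, q, r]"
    using assms(2) by (auto simp: numeral_3_eq_3 length_Suc_conv)
  moreover obtain x y z where "w = [x, y, z]"
    using assms(1) by (auto simp: ds hom_word_def list_all2_Cons1)
  ultimately show thesis
    using that assms(1) by simp
qed

lemma bit_sum_pair: "sum_list [p, q] = d \<longleftrightarrow> q = p + (d::bit)"
  by (cases p; cases q; cases d) auto

lemma koszul_pair: "koszul [p, q] [p', q'] = q * p'"
  by (simp add: koszul_def lessThan_Suc)

lemma koszul_triple: "koszul [p, q, r] [p', q', r'] = q * p' + r * (p' + q')"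
  by (simp add: koszul_def lessThan_Suc distrib_left ac_simps)

section \<open>Scaling formal tensors\<close>

text \<open>The scalar goes to the first letter, by convention; \<open>fscale_word\<close> shows that any other letter
would do.\<close>

definition fscale :: "'k \<Rightarrow> 'a formal \<Rightarrow> 'a formal" where
  "fscale k = frag_extend (word_smult A k)"

lemma fscale_word: "fscale k (frag_of (xs @ [a] @ ys)) \<simeq> frag_of (xs @ [smult A k a] @ ys)"
proof (cases xs)
  case (Cons x xs')
  then show ?thesis
    using teq_slot_smult[of "[]" k x xs' a ys] by (simp add: fscale_def word_smult_def)
qed (simp add: fscale_def word_smult_def)

lemma fscale_teq:
  assumes "s \<simeq> t" shows "fscale k s \<simeq> fscale k t"
  unfolding fscale_def
proof (rule teq_frag_extend[OF _ _ assms])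
  show "word_smult A k (xs @ [a + b] @ ys) \<simeq> word_smult A k (xs @ [a] @ ys) + word_smult A k (xs @ [b] @ ys)"
    for xs a b ys
  proof (cases xs)
    case Nil
    then show ?thesis
      using teq_slot_add[of "[]" "smult A k a" "smult A k b" ys]
      by (simp add: word_smult_def vs.scale_right_distrib)
  next
    case (Cons x xs')
    then show ?thesis
      using teq_slot_add[of "smult A k x # xs'" a b ys] by (simp add: word_smult_def)
  qed
  show "word_smult A k (xs @ [smult A l a] @ ys @ [b] @ zs) \<simeq> word_smult A k (xs @ [a] @ ys @ [smult A l b] @ zs)"
    for xs l a ys b zs
  proof (cases xs)
    case Nil
    then show ?thesis
      using teq_slot_smult[of "[]" l "smult A k a" ys b zs]
      by (simp add: word_smult_def mult.commute)
  next
    case (Cons x xs')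
    then show ?thesis
      using teq_slot_smult[of "smult A k x # xs'" l a ys b zs] by (simp add: word_smult_def)
  qed
qed

end

section \<open>Comultiplication and counit on a tensor factor\<close>

context quasi_hopf_superalgebra
begin

notation teq  (infix \<open>\<simeq>\<close> 50)

lemma antipode_add: "antipode Q (a + b) = antipode Q a + antipode Q b"
proof -
  interpret S: Vector_Spaces.linear "smult Q" "smult Q" "antipode Q"
    by (rule antipode_linear)
  show ?thesis by (rule S.add)
qed

lemma antipode_smult: "antipode Q (smult Q k a) = smult Q k (antipode Q a)"
proof -
  interpret S: Vector_Spaces.linear "smult Q" "smult Q" "antipode Q"
    by (rule antipode_linear)
  show ?thesis by (rule S.scale)
qed

lemma antipode_zero: "antipode Q 0 = 0"
  using antipode_smult[of 0 0] by simp

lemma antipode_diff: "antipode Q (a - b) = antipode Q a - antipode Q b"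
  using antipode_add[of "a - b" b] by simp

lemma counit_add: "counit Q (a + b) = counit Q a + counit Q b"
proof -
  interpret E: Vector_Spaces.linear "smult Q" "(*)" "counit Q"
    by (rule counit_linear)
  show ?thesis by (rule E.add)
qed

lemma counit_smult: "counit Q (smult Q k a) = k * counit Q a"
proof -
  interpret E: Vector_Spaces.linear "smult Q" "(*)" "counit Q"
    by (rule counit_linear)
  show ?thesis by (rule E.scale)
qed

text \<open>The map \<open>comult_at\<close> on a single word, with the nested juxtaposition multiplied out.\<close>

definition comult_word :: "nat \<Rightarrow> 'a list \<Rightarrow> 'a formal" where
  "comult_word i w = (if i < length w
     then frag_extend (\<lambda>v. frag_of (take i w @ v @ drop (Suc i) w)) (rep (comult Q (w ! i)))
     else 0)"

lemma rep_comult_add: "rep (comult Q (a + b)) \<simeq> rep (comult Q a) + rep (comult Q b)"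
  unfolding comult_add tadd_def by (rule rep_tclass)

lemma rep_comult_smult: "rep (comult Q (smult Q k a)) \<simeq> fscale k (rep (comult Q a))"
  unfolding comult_smult tsmult_def fscale_def by (rule rep_tclass)

lemma teq_insert: "s \<simeq> t \<Longrightarrow> frag_extend (\<lambda>v. frag_of (xs @ v @ ys)) s \<simeq> frag_extend (\<lambda>v. frag_of (xs @ v @ ys)) t"
proof (rule teq_frag_extend)
  show "frag_of (xs @ (us @ [a + b] @ vs) @ ys) \<simeq> frag_of (xs @ (us @ [a] @ vs) @ ys) + frag_of (xs @ (us @ [b] @ vs) @ ys)"
    for us a b vs using teq_slot_add[of "xs @ us" a b "vs @ ys"] by simp
  show "frag_of (xs @ (us @ [smult Q k a] @ vs @ [b] @ ws) @ ys) \<simeq> frag_of (xs @ (us @ [a] @ vs @ [smult Q k b] @ ws) @ ys)"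
    for us k a vs b ws using teq_slot_smult[of "xs @ us" k a vs b "ws @ ys"] by simp
qed

lemma frag_extend_fun_add: "frag_extend (\<lambda>v. f v + g v) s = frag_extend f s + frag_extend g s"
  by (simp add: frag_extend_def frag_cmul_distrib2 sum.distrib)

lemma fscale_frag_extend: "fscale k (frag_extend f s) = frag_extend (\<lambda>v. fscale k (f v)) s"
  using subset_UNIV
proof (induction s rule: frag_induction)
  case (diff s t)
  then show ?case by (simp add: frag_extend_diff fscale_def)
qed (simp_all add: fscale_def)

text \<open>The behaviour of \<open>comult_word\<close> in one slot depends on whether the slot is the one that is
comultiplied. Otherwise the letter \<open>a\<close> is carried along as a letter of every resulting word.\<close>

lemma comult_word_slot:
  "(\<exists>f g (d :: 'a formal). \<forall>a. comult_word i (xs @ [a] @ ys) = frag_extend (\<lambda>v. frag_of (f v @ [a] @ g v)) d) \<or>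
   (\<forall>a. comult_word i (xs @ [a] @ ys) = frag_extend (\<lambda>v. frag_of (xs @ v @ ys)) (rep (comult Q a)))"
  (is "?outside \<or> ?inside")
proof -
  have outside: ?outside
    if "\<And>a. comult_word i (xs @ [a] @ ys) = frag_extend (\<lambda>v. frag_of (f v @ [a] @ g v)) d" for f g and d :: "'a formal"
    by (intro exI allI) (rule that)
  consider "i < length xs" | "i = length xs" | m where "i = Suc (length xs + m)"
    by (metis less_imp_Suc_add linorder_neqE_nat)
  then show ?thesis
  proof cases
    case 1
    have ?outside
      by (rule outside[of "\<lambda>v. take i xs @ v @ drop (Suc i) xs" "\<lambda>v. ys" "rep (comult Q (xs ! i))"])
        (use 1 in \<open>simp add: comult_word_def nth_append\<close>)
    then show ?thesis ..
  next
    case 2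
    then have ?inside by (simp add: comult_word_def)
    then show ?thesis ..
  next
    case 3
    have ?outside
      by (rule outside[of "\<lambda>v. xs" "\<lambda>v. take m ys @ v @ drop (Suc m) ys"
            "if m < length ys then rep (comult Q (ys ! m)) else 0"])
        (simp add: comult_word_def nth_append 3)
    then show ?thesis ..
  qed
qed

lemma comult_word_add:
  "comult_word i (xs @ [a + b] @ ys) \<simeq> comult_word i (xs @ [a] @ ys) + comult_word i (xs @ [b] @ ys)"
  using comult_word_slot[of i xs ys]
proof (elim disjE exE)
  fix f g and d :: "'a formal"
  assume outside: "\<forall>a. comult_word i (xs @ [a] @ ys) = frag_extend (\<lambda>v. frag_of (f v @ [a] @ g v)) d"
  show ?thesis
    unfolding outside[rule_format] frag_extend_fun_add[symmetric]
    by (intro teq_frag_extend_pointwise teq_slot_add)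
next
  assume inside: "\<forall>a. comult_word i (xs @ [a] @ ys) = frag_extend (\<lambda>v. frag_of (xs @ v @ ys)) (rep (comult Q a))"
  show ?thesis
    unfolding inside[rule_format] frag_extend_add[symmetric] by (rule teq_insert[OF rep_comult_add])
qed

text \<open>In the comultiplied slot, the scalar lands on the first leg of the coproduct. This is a letter of the
result only if the words representing the coproduct are nonempty, whence the passage to a
representative by words of length 2.\<close>

lemma comult_word_smult:
  "comult_word i (xs @ [smult Q k a] @ ys) \<simeq> fscale k (comult_word i (xs @ [a] @ ys))"
  using comult_word_slot[of i xs ys]
proof (elim disjE exE)
  fix f g and d :: "'a formal"
  assume outside: "\<forall>a. comult_word i (xs @ [a] @ ys) = frag_extend (\<lambda>v. frag_of (f v @ [a] @ g v)) d"
  show ?thesis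
    unfolding outside[rule_format] fscale_frag_extend
    by (intro teq_frag_extend_pointwise teq_sym[OF fscale_word])
next
  assume inside: "\<forall>a. comult_word i (xs @ [a] @ ys) = frag_extend (\<lambda>v. frag_of (xs @ v @ ys)) (rep (comult Q a))"
  let ?G = "frag_extend (\<lambda>v. frag_of (xs @ v @ ys))"
  obtain s where s: "comult Q a = tclass Q s" "homog (\<lambda>ds. length ds = 2) s"
    using comult_tpower[of a] by (auto simp: tpower_iff)
  have rep: "rep (comult Q a) \<simeq> s"
    unfolding s(1) by (rule rep_tclass)
  have G: "?G (fscale k s) \<simeq> fscale k (?G s)"
    using s(2)
  proof (induction rule: homog_induct)
    case (word ds w)
    obtain p q x y where w: "w = [x, y]"
      using hom_word_2E[OF word] by metis
    show ?case
      using teq_sym[OF fscale_word[of k xs x "y # ys"]] by (simp add: w fscale_def word_smult_def)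
  qed (simp_all add: fscale_def frag_extend_diff teq_diff)
  have "?G (rep (comult Q (smult Q k a))) \<simeq> ?G (fscale k (rep (comult Q a)))"
    by (rule teq_insert[OF rep_comult_smult])
  also have "\<dots> \<simeq> ?G (fscale k s)"
    by (intro teq_insert fscale_teq rep)
  also have "\<dots> \<simeq> fscale k (?G s)"
    by (rule G)
  also have "\<dots> \<simeq> fscale k (?G (rep (comult Q a)))"
    by (intro fscale_teq teq_insert teq_sym[OF rep])
  finally show ?thesis
    unfolding inside[rule_format] .
qed

lemma comult_at_tclass: "comult_at Q i (tclass Q s) = tclass Q (frag_extend (comult_word i) s)"
proof -
  have "comult_at Q i (tclass Q s) = tclass Q (frag_extend (comult_word i) (rep (tclass Q s)))"
  proof -
    have "juxtapose (frag_of xs) (juxtapose d (frag_of ys)) = frag_extend (\<lambda>v. frag_of (xs @ v @ ys)) d" for xs ys and d :: "'a formal"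
      using subset_UNIV
      by (induction d rule: frag_induction) (simp_all add: frag_extend_diff juxtapose_diff_right)
    then show ?thesis
      by (simp add: comult_at_def comult_word_def[abs_def] cong: if_cong)
  qed
  also have "\<dots> = tclass Q (frag_extend (comult_word i) s)"
    unfolding tclass_eq_iff
  proof (rule teq_frag_extend[OF comult_word_add _ rep_tclass])
    fix xs a ys b zs k
    have "comult_word i (xs @ [smult Q k a] @ ys @ [b] @ zs) \<simeq> fscale k (comult_word i (xs @ [a] @ ys @ [b] @ zs))"
      by (rule comult_word_smult)
    also have "\<dots> \<simeq> comult_word i (xs @ [a] @ ys @ [smult Q k b] @ zs)"
      using teq_sym[OF comult_word_smult[of i "xs @ [a] @ ys" k b zs]] by simp
    finally show "comult_word i (xs @ [smult Q k a] @ ys @ [b] @ zs) \<simeq> comult_word i (xs @ [a] @ ys @ [smult Q k b] @ zs)" .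
  qed
  finally show ?thesis .
qed

lemma comult_word_representative:
  assumes "i < length w" "comult Q (w ! i) = tclass Q s"
  shows "comult_word i w \<simeq> frag_extend (\<lambda>v. frag_of (take i w @ v @ drop (Suc i) w)) s"
  using assms by (simp add: comult_word_def teq_insert rep_tclass)

lemma comult_at_tpower:
  assumes "X \<in> tpower Q n" "i < n" shows "comult_at Q i X \<in> tpower Q (Suc n)"
proof -
  obtain s where s: "X = tclass Q s" "homog (\<lambda>ds. length ds = n) s"
    using assms(1) by (auto simp: tpower_iff)
  have "tclass Q (frag_extend (comult_word i) s) \<in> tpower Q (Suc n)"
    using s(2)
  proof (induction rule: homog_induct)
    case zero
    show ?case by (auto simp: tpower_iff intro!: exI[of _ 0])
  next
    case (word ds w)
    have n: "length w = n"
      using word by (simp add: hom_word_length)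
    obtain t where t: "comult Q (w ! i) = tclass Q t" "\<forall>v\<in>Poly_Mapping.keys t. length v = 2"
      using comult_tpower[of "w ! i"] by (auto simp: tpower_def)
    let ?t = "frag_extend (\<lambda>v. frag_of (take i w @ v @ drop (Suc i) w)) t"
    have "\<forall>v\<in>Poly_Mapping.keys ?t. length v = Suc n"
      using t(2) n assms(2) by (auto elim!: keys_frag_extendE)
    moreover have "tclass Q (comult_word i w) = tclass Q ?t"
      unfolding tclass_eq_iff using n assms(2) t(1) by (intro comult_word_representative) auto
    ultimately show ?case
      unfolding tpower_def frag_extend_of by blast
  next
    case (diff s t)
    then show ?case by (simp add: frag_extend_diff tpower_diff)
  qed
  then show ?thesis
    by (simp add: s(1) comult_at_tclass)
qed

abbreviation counit_first :: "'a \<Rightarrow> 'a \<Rightarrow> 'a" where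
  "counit_first x y \<equiv> smult Q (counit Q x) y"

abbreviation counit_second :: "'a \<Rightarrow> 'a \<Rightarrow> 'a" where
  "counit_second x y \<equiv> smult Q (counit Q y) x"

lemma multilinear_counit_first: "multilinear (\<lambda>w. case w of [x, y] \<Rightarrow> counit_first x y | _ \<Rightarrow> 0)"
  by (rule multilinear_pair)
    (simp_all add: counit_add counit_smult vs.scale_left_distrib vs.scale_right_distrib mult.commute)

lemma multilinear_counit_second: "multilinear (\<lambda>w. case w of [x, y] \<Rightarrow> counit_second x y | _ \<Rightarrow> 0)"
  by (rule multilinear_pair)
    (simp_all add: counit_add counit_smult vs.scale_left_distrib vs.scale_right_distrib mult.commute)

lemma multilinear_single: "multilinear (\<lambda>w. case w of [x] \<Rightarrow> x | _ \<Rightarrow> 0)"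
  unfolding multilinear_def by (auto simp: append_eq_Cons_conv split: list.split)

text \<open>For \<open>X = \<Sum> x \<otimes> y\<close>, the element \<open>\<Sum> \<epsilon>(x) y\<close> or \<open>\<Sum> \<epsilon>(y) x\<close> of \<open>A\<close> is the single letter of
\<open>counit_at Q i X\<close>.\<close>

lemma contract_counit:
  assumes "counit_at Q i X = pure Q [1]" "i < 2"
  shows "contract2 (if i = 0 then counit_first else counit_second) X = 1"
proof -
  let ?id = "\<lambda>w. case w of [x] \<Rightarrow> x | _ \<Rightarrow> (0::'a)"
  let ?c = "\<lambda>w. if i < length w then word_smult Q (counit Q (w ! i)) (take i w @ drop (Suc i) w) else 0"
  let ?e = "\<lambda>w. case w of [x, y] \<Rightarrow> (if i = 0 then counit_first else counit_second) x y | _ \<Rightarrow> 0"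
  have "feval ?id (?c w) = ?e w" for w
  proof -
    consider "i = 0" | "i = 1"
      using assms(2) by linarith
    then show ?thesis
      by cases (simp_all add: word_smult_def split: list.split)
  qed
  then have "contract2 (if i = 0 then counit_first else counit_second) X
      = feval ?id (frag_extend ?c (rep X))"
    unfolding contract2_def contract_feval feval_frag_extend by simp
  also have "\<dots> = contract ?id (counit_at Q i X)"
    unfolding counit_at_def by (rule contract_tclass[OF multilinear_single, symmetric])
  also have "\<dots> = 1"
    unfolding assms(1) pure_def by (simp add: contract_tclass[OF multilinear_single])
  finally show ?thesis .
qed

text \<open>The map \<open>1 \<otimes> \<epsilon>\<close> is multiplicative without a sign: the sign is \<open>(-1)\<^bsup>[f'][g]\<^esup>\<close>, and \<open>\<epsilon>(f')\<close> vanishes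
for odd \<open>f'\<close>. It is used to obtain \<open>(1 \<otimes> \<epsilon>)F\<^sup>-\<^sup>1 = 1\<close> from \<open>(1 \<otimes> \<epsilon>)F = 1\<close>.\<close>

lemma contract_counit_second_mult:
  assumes "X \<in> tgrade Q 2 0" "Y \<in> tpower Q 2"
  shows "contract2 counit_second (X \<odot> Y) = contract2 counit_second X * contract2 counit_second Y"
proof -
  let ?e = "\<lambda>w. case w of [x, y] \<Rightarrow> counit_second x y | _ \<Rightarrow> 0"
  have "feval ?e (fmult s t) = feval ?e s * feval ?e t"
    if s: "homog (\<lambda>ds. length ds = 2 \<and> sum_list ds = 0) s" and t: "homog (\<lambda>ds. length ds = 2) t" for s t
    using s
  proof (induction rule: homog_induct)
    case s: (word ds w)
    obtain p f f' where w: "ds = [p, p]" "w = [f, f']" "f \<in> grade Q p" "f' \<in> grade Q p"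
      using hom_word_2E[OF s(1)] s(2) bit_sum_pair by (metis add.right_neutral)
    show ?case using t
    proof (induction rule: homog_induct)
      case t: (word es v)
      obtain q q' g g' where v: "es = [q, q']" "v = [g, g']" "g \<in> grade Q q" "g' \<in> grade Q q'"
        using hom_word_2E[OF t] by metis
      have "feval ?e (fmult (frag_of w) (frag_of v))
          = of_int (sign (p * q)) * smult Q (counit Q (f' * g')) (f * g)"
        using feval_word_mult[OF multilinear_counit_second s(1) t(1)] by (simp add: w v koszul_pair)
      also have "\<dots> = ?e w * ?e v"
        using w(4) counit_grade
        by (cases p) (auto simp: w(2) v(2) counit_mult smult_mult_left smult_mult_right mult.commute)
      finally show ?case by simp
    qed (simp_all add: fmult_diff_right feval_diff right_diff_distrib)
  qed (simp_all add: fmult_diff_left feval_diff left_diff_distrib)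
  then show ?thesis
    using assms unfolding tgrade_iff tpower_iff contract2_def
    by (elim exE conjE) (simp add: tmult_tclass contract_tclass[OF multilinear_counit_second])
qed

section \<open>Absorbing the factors of the twisted associator\<close>

abbreviation sandwich :: "'a \<Rightarrow> 'a \<Rightarrow> 'a \<Rightarrow> 'a \<Rightarrow> 'a \<Rightarrow> 'a" where
  "sandwich a b x y z \<equiv> antipode Q x * a * y * b * antipode Q z"

abbreviation left_bracket :: "'a \<Rightarrow> 'a \<Rightarrow> 'a \<Rightarrow> 'a" where
  "left_bracket a x y \<equiv> antipode Q x * a * y"

abbreviation right_bracket :: "'a \<Rightarrow> 'a \<Rightarrow> 'a \<Rightarrow> 'a" where
  "right_bracket b x y \<equiv> x * b * antipode Q y"

lemma multilinear_sandwich: "multilinear (\<lambda>w. case w of [x, y, z] \<Rightarrow> sandwich a b x y z | _ \<Rightarrow> 0)"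
  by (rule multilinear_triple)
    (simp_all add: antipode_add antipode_smult distrib_left distrib_right smult_mult_left smult_mult_right)

lemma multilinear_left_bracket: "multilinear (\<lambda>w. case w of [x, y] \<Rightarrow> left_bracket a x y | _ \<Rightarrow> 0)"
  by (rule multilinear_pair)
    (simp_all add: antipode_add antipode_smult distrib_left distrib_right smult_mult_left smult_mult_right)

lemma multilinear_right_bracket: "multilinear (\<lambda>w. case w of [x, y] \<Rightarrow> right_bracket b x y | _ \<Rightarrow> 0)"
  by (rule multilinear_pair)
    (simp_all add: antipode_add antipode_smult distrib_left distrib_right smult_mult_left smult_mult_right)

lemmas contract_sandwich = contract_tclass[OF multilinear_sandwich]
  and contract_left_bracket = contract_tclass[OF multilinear_left_bracket]
  and contract_right_bracket = contract_tclass[OF multilinear_right_bracket]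

text \<open>With \<open>u\<^sub>1\<close> and \<open>u\<^sub>2\<close> both of degree \<open>p\<close>, moving \<open>u\<^sub>2\<close> past \<open>x\<close> in the product gives
\<open>(-1)\<^bsup>p[x]\<^esup>\<close>, and so does \<open>S(u\<^sub>1 x) = (-1)\<^bsup>p[x]\<^esup> S(x) S(u\<^sub>1)\<close>; the two signs cancel. Here the evenness of
\<open>U\<close> is essential.\<close>

lemma sandwich_left_factor:
  assumes "U \<in> tgrade Q 2 0" "T \<in> tpower Q 3"
  shows "contract3 (sandwich a b) ((U \<otimes> pure Q [1]) \<odot> T)
       = contract3 (sandwich (contract2 (left_bracket a) U) b) T"
proof -
  let ?m = "\<lambda>a w. case w of [x, y, z] \<Rightarrow> sandwich a b x y z | _ \<Rightarrow> 0"
  let ?g = "\<lambda>w. case w of [x, y] \<Rightarrow> left_bracket a x y | _ \<Rightarrow> 0"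
  obtain s where U: "U = tclass Q s" and s: "homog (\<lambda>ds. length ds = 2 \<and> sum_list ds = 0) s"
    using assms(1) by (auto simp: tgrade_iff)
  obtain t where T: "T = tclass Q t" and t: "homog (\<lambda>ds. length ds = 3) t"
    using assms(2) by (auto simp: tpower_iff)
  have "feval (?m a) (fmult (juxtapose s (frag_of [1])) t) = feval (?m (feval ?g s)) t"
    using t
  proof (induction rule: homog_induct)
    case t: (word es w)
    obtain i j k x y z where w: "es = [i, j, k]" "w = [x, y, z]" "x \<in> grade Q i" "y \<in> grade Q j" "z \<in> grade Q k"
      using hom_word_3E[OF t] by metis
    have "feval (?m a) (fmult (juxtapose s (frag_of [1])) (frag_of w)) = sandwich (feval ?g s) b x y z"
      using s
    proof (induction rule: homog_induct)
      case s: (word ds v)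
      obtain p f f' where v: "ds = [p, p]" "v = [f, f']" "f \<in> grade Q p" "f' \<in> grade Q p"
        using hom_word_2E[OF s(1)] s(2) bit_sum_pair by (metis add.right_neutral)
      have "feval (?m a) (word_mult Q [f, f', 1] [x, y, z])
          = of_int (sign (p * i)) * sandwich a b (f * x) (f' * y) z"
        using feval_word_mult[OF multilinear_sandwich, of "[p, p, 0]" "[f, f', 1]" "[i, j, k]" "[x, y, z]"] v w
        by (simp add: koszul_triple grade_one)
      also have "\<dots> = sandwich (left_bracket a f f') b x y z"
        unfolding antipode_mult[OF v(3) w(3)]
        by (cases p; cases i) (simp_all add: sign_def mult.assoc)
      finally show ?case by (simp add: v w)
    qed (simp_all add: fmult_diff_left feval_diff left_diff_distrib right_diff_distrib)
    then show ?case by (simp add: w)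
  qed (simp_all add: fmult_diff_right feval_diff)
  then show ?thesis
    unfolding contract2_def contract3_def
    by (simp add: U T pure_def tjoin_tclass tmult_tclass contract_sandwich contract_left_bracket)
qed

text \<open>The mirror image: \<open>u\<^sub>1\<close> moves past \<open>z\<close> in the product, and \<open>S(z u\<^sub>2)\<close> reverses \<open>z\<close> and \<open>u\<^sub>2\<close>.\<close>

lemma sandwich_right_factor:
  assumes "U \<in> tgrade Q 2 0" "T \<in> tpower Q 3"
  shows "contract3 (sandwich a b) (T \<odot> (pure Q [1] \<otimes> U))
       = contract3 (sandwich a (contract2 (right_bracket b) U)) T"
proof -
  let ?m = "\<lambda>b w. case w of [x, y, z] \<Rightarrow> sandwich a b x y z | _ \<Rightarrow> 0"
  let ?g = "\<lambda>w. case w of [x, y] \<Rightarrow> right_bracket b x y | _ \<Rightarrow> 0"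
  obtain s where U: "U = tclass Q s" and s: "homog (\<lambda>ds. length ds = 2 \<and> sum_list ds = 0) s"
    using assms(1) by (auto simp: tgrade_iff)
  obtain t where T: "T = tclass Q t" and t: "homog (\<lambda>ds. length ds = 3) t"
    using assms(2) by (auto simp: tpower_iff)
  have "feval (?m b) (fmult t (juxtapose (frag_of [1]) s)) = feval (?m (feval ?g s)) t"
    using t
  proof (induction rule: homog_induct)
    case t: (word es w)
    obtain i j k x y z where w: "es = [i, j, k]" "w = [x, y, z]" "x \<in> grade Q i" "y \<in> grade Q j" "z \<in> grade Q k"
      using hom_word_3E[OF t] by metis
    have "feval (?m b) (fmult (frag_of w) (juxtapose (frag_of [1]) s)) = sandwich a (feval ?g s) x y z"
      using s
    proof (induction rule: homog_induct)
      case s: (word ds v)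
      obtain p f f' where v: "ds = [p, p]" "v = [f, f']" "f \<in> grade Q p" "f' \<in> grade Q p"
        using hom_word_2E[OF s(1)] s(2) bit_sum_pair by (metis add.right_neutral)
      have "feval (?m b) (word_mult Q [x, y, z] [1, f, f'])
          = of_int (sign (k * p)) * sandwich a b x (y * f) (z * f')"
        using feval_word_mult[OF multilinear_sandwich, of "[i, j, k]" "[x, y, z]" "[0, p, p]" "[1, f, f']"] v w
        by (simp add: koszul_triple grade_one)
      also have "\<dots> = sandwich a (right_bracket b f f') x y z"
        unfolding antipode_mult[OF w(5) v(4)]
        by (cases p; cases k) (simp_all add: sign_def mult.assoc)
      finally show ?case by (simp add: v w)
    qed (simp_all add: fmult_diff_right juxtapose_diff_right feval_diff left_diff_distrib right_diff_distrib)
    then show ?case by (simp add: w)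
  qed (simp_all add: fmult_diff_left feval_diff)
  then show ?thesis
    unfolding contract2_def contract3_def
    by (simp add: U T pure_def tjoin_tclass tmult_tclass contract_sandwich contract_right_bracket)
qed

text \<open>For \<open>U = \<Sum> f \<otimes> f'\<close> the factor contributes \<open>S(x) (\<Sum> S(f\<^sub>1) a f\<^sub>2) y b S(f' z)\<close>. By the hypothesis on
\<open>a\<close> the bracket is \<open>\<epsilon>(f) a\<close>, and the scalars assemble to \<open>\<Sum> \<epsilon>(f) f' = 1\<close> in the last argument. The
sign that is left over, \<open>(-1)\<^bsup>[f][y]\<^esup>\<close>, is trivial unless \<open>f\<close> is odd, and then \<open>\<epsilon>(f) = 0\<close>.\<close>

lemma sandwich_comult_left:
  assumes a: "\<And>x. contract2 (left_bracket a) (comult Q x) = smult Q (counit Q x) a"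
    and "U \<in> tgrade Q 2 0" "contract2 counit_first U = 1" "T \<in> tpower Q 3"
  shows "contract3 (sandwich a b) (comult_at Q 0 U \<odot> T) = contract3 (sandwich a b) T"
proof -
  let ?m = "\<lambda>w. case w of [x, y, z] \<Rightarrow> sandwich a b x y z | _ \<Rightarrow> 0"
  let ?g = "\<lambda>w. case w of [x, y] \<Rightarrow> left_bracket a x y | _ \<Rightarrow> 0"
  let ?e = "\<lambda>w. case w of [x, y] \<Rightarrow> counit_first x y | _ \<Rightarrow> 0"
  obtain s where U: "U = tclass Q s" and s: "homog (\<lambda>ds. length ds = 2 \<and> sum_list ds = 0) s"
    using assms(2) by (auto simp: tgrade_iff)
  obtain t where T: "T = tclass Q t" and t: "homog (\<lambda>ds. length ds = 3) t"
    using assms(4) by (auto simp: tpower_iff)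
  have one: "feval ?e s = 1"
    using assms(3) by (simp add: U contract2_def contract_tclass[OF multilinear_counit_first])
  have "feval ?m (fmult (frag_extend (comult_word 0) s) t) = feval ?m t"
    using t
  proof (induction rule: homog_induct)
    case t: (word es w)
    obtain i j k x y z where w: "es = [i, j, k]" "w = [x, y, z]" "x \<in> grade Q i" "y \<in> grade Q j" "z \<in> grade Q k"
      using hom_word_3E[OF t] by metis
    have "feval ?m (fmult (frag_extend (comult_word 0) s) (frag_of w)) = sandwich a b x y (feval ?e s * z)"
      using s
    proof (induction rule: homog_induct)
      case zero
      show ?case by (simp add: antipode_zero)
    next
      case s: (word ds v)
      obtain p f f' where v: "ds = [p, p]" "v = [f, f']" "f \<in> grade Q p" "f' \<in> grade Q p"
        using hom_word_2E[OF s(1)] s(2) bit_sum_pair by (metis add.right_neutral)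
      obtain d where d: "comult Q f = tclass Q d" and hom: "homog (\<lambda>ds. length ds = 2 \<and> sum_list ds = p) d"
        using comult_grade[OF v(3)] by (auto simp: tgrade_iff)
      let ?D = "frag_extend (\<lambda>u. frag_of (u @ [f']))"
      have "comult_word 0 v \<simeq> ?D d"
        using comult_word_representative[of 0 v] d v(2) by simp
      then have "feval ?m (fmult (comult_word 0 v) (frag_of w)) = feval ?m (fmult (?D d) (frag_of w))"
        by (intro multilinear_feval_teq[OF multilinear_sandwich] fmult_teq teq_refl)
      also have "\<dots> = of_int (sign (p * j)) * sandwich (feval ?g d) b x y (f' * z)"
        using hom
      proof (induction rule: homog_induct)
        case u: (word us u)
        obtain q q' h h' where u': "us = [q, q']" "u = [h, h']" "h \<in> grade Q q" "h' \<in> grade Q q'"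
          using hom_word_2E[OF u(1)] u(2) by metis
        have p: "p = q + q'"
          using u(2) u'(1) by simp
        have "feval ?m (word_mult Q [h, h', f'] [x, y, z])
            = of_int (sign (q' * i + p * (i + j))) * sandwich a b (h * x) (h' * y) (f' * z)"
          using feval_word_mult[OF multilinear_sandwich, of "[q, q', p]" "[h, h', f']" "[i, j, k]" "[x, y, z]"] u' v w
          by (simp add: koszul_triple)
        \<comment> \<open>The antipode contributes \<open>q * i\<close>, and \<open>q * i + q' * i + p * (i + j) = p * j\<close> modulo 2
          since \<open>p = q + q'\<close>. So the sign no longer depends on the term of the coproduct.\<close>
        also have "\<dots> = of_int (sign (p * j)) * sandwich (left_bracket a h h') b x y (f' * z)"
          unfolding antipode_mult[OF u'(3) w(3)] p
          by (cases q; cases q'; cases i; cases j) (simp_all add: sign_def mult.assoc)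
        finally show ?case by (simp add: u' w)
      qed (simp_all add: frag_extend_diff fmult_diff_left feval_diff left_diff_distrib right_diff_distrib)
      also have "feval ?g d = smult Q (counit Q f) a"
        using a[of f] unfolding d contract2_def contract_left_bracket .
      also have "of_int (sign (p * j)) * sandwich (smult Q (counit Q f) a) b x y (f' * z)
          = sandwich a b x y (counit_first f f' * z)"
      proof (cases "p = 0")
        case True
        then show ?thesis by (simp add: smult_mult_left smult_mult_right antipode_smult)
      next
        case False
        then have "counit Q f = 0"
          using counit_grade[of f] v(3) by simp
        then show ?thesis by (simp add: antipode_zero)
      qed
      finally show ?case by (simp add: v)
    next
      case (diff s s')
      then show ?case
        by (simp add: frag_extend_diff fmult_diff_left feval_diff antipode_diff left_diff_distrib right_diff_distrib)
    qed
    then show ?case by (simp add: w one)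
  qed (simp_all add: fmult_diff_right feval_diff)
  then show ?thesis
    unfolding contract3_def by (simp add: U T comult_at_tclass tmult_tclass contract_sandwich)
qed

text \<open>The mirror image: for \<open>U = \<Sum> f \<otimes> f'\<close> the bracket \<open>\<Sum> f'\<^sub>1 b S(f'\<^sub>2) = \<epsilon>(f') b\<close> appears on the right of
\<open>y\<close>, and the scalars assemble to \<open>\<Sum> \<epsilon>(f') f = 1\<close> in the first argument.\<close>

lemma sandwich_comult_right:
  assumes b: "\<And>x. contract2 (right_bracket b) (comult Q x) = smult Q (counit Q x) b"
    and "U \<in> tgrade Q 2 0" "contract2 counit_second U = 1" "T \<in> tpower Q 3"
  shows "contract3 (sandwich a b) (T \<odot> comult_at Q 1 U) = contract3 (sandwich a b) T"
proof -
  let ?m = "\<lambda>w. case w of [x, y, z] \<Rightarrow> sandwich a b x y z | _ \<Rightarrow> 0"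
  let ?g = "\<lambda>w. case w of [x, y] \<Rightarrow> right_bracket b x y | _ \<Rightarrow> 0"
  let ?e = "\<lambda>w. case w of [x, y] \<Rightarrow> counit_second x y | _ \<Rightarrow> 0"
  obtain s where U: "U = tclass Q s" and s: "homog (\<lambda>ds. length ds = 2 \<and> sum_list ds = 0) s"
    using assms(2) by (auto simp: tgrade_iff)
  obtain t where T: "T = tclass Q t" and t: "homog (\<lambda>ds. length ds = 3) t"
    using assms(4) by (auto simp: tpower_iff)
  have one: "feval ?e s = 1"
    using assms(3) by (simp add: U contract2_def contract_tclass[OF multilinear_counit_second])
  have "feval ?m (fmult t (frag_extend (comult_word 1) s)) = feval ?m t"
    using t
  proof (induction rule: homog_induct)
    case t: (word es w)
    obtain i j k x y z where w: "es = [i, j, k]" "w = [x, y, z]" "x \<in> grade Q i" "y \<in> grade Q j" "z \<in> grade Q k"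
      using hom_word_3E[OF t] by metis
    have "feval ?m (fmult (frag_of w) (frag_extend (comult_word 1) s)) = sandwich a b (x * feval ?e s) y z"
      using s
    proof (induction rule: homog_induct)
      case zero
      show ?case by (simp add: antipode_zero)
    next
      case s: (word ds v)
      obtain p f f' where v: "ds = [p, p]" "v = [f, f']" "f \<in> grade Q p" "f' \<in> grade Q p"
        using hom_word_2E[OF s(1)] s(2) bit_sum_pair by (metis add.right_neutral)
      obtain d where d: "comult Q f' = tclass Q d" and hom: "homog (\<lambda>ds. length ds = 2 \<and> sum_list ds = p) d"
        using comult_grade[OF v(4)] by (auto simp: tgrade_iff)
      let ?D = "frag_extend (\<lambda>u. frag_of ([f] @ u))"
      have "comult_word 1 v \<simeq> ?D d"
        using comult_word_representative[of 1 v] d v(2) by simp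
      then have "feval ?m (fmult (frag_of w) (comult_word 1 v)) = feval ?m (fmult (frag_of w) (?D d))"
        by (intro multilinear_feval_teq[OF multilinear_sandwich] fmult_teq teq_refl)
      also have "\<dots> = of_int (sign (p * j)) * sandwich a (feval ?g d) (x * f) y z"
        using hom
      proof (induction rule: homog_induct)
        case u: (word us u)
        obtain q q' h h' where u': "us = [q, q']" "u = [h, h']" "h \<in> grade Q q" "h' \<in> grade Q q'"
          using hom_word_2E[OF u(1)] u(2) by metis
        have p: "p = q + q'"
          using u(2) u'(1) by simp
        have "feval ?m (word_mult Q [x, y, z] [f, h, h'])
            = of_int (sign (j * p + k * (p + q))) * sandwich a b (x * f) (y * h) (z * h')"
          using feval_word_mult[OF multilinear_sandwich, of "[i, j, k]" "[x, y, z]" "[p, q, q']" "[f, h, h']"] u' v w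
          by (simp add: koszul_triple)
        \<comment> \<open>The antipode contributes \<open>k * q'\<close>, which cancels \<open>k * (p + q)\<close> modulo 2.\<close>
        also have "\<dots> = of_int (sign (p * j)) * sandwich a (right_bracket b h h') (x * f) y z"
          unfolding antipode_mult[OF w(5) u'(4)] p
          by (cases q; cases q'; cases j; cases k) (simp_all add: sign_def mult.assoc)
        finally show ?case by (simp add: u' w)
      qed (simp_all add: frag_extend_diff fmult_diff_right feval_diff left_diff_distrib right_diff_distrib)
      also have "feval ?g d = smult Q (counit Q f') b"
        using b[of f'] unfolding d contract2_def contract_right_bracket .
      also have "of_int (sign (p * j)) * sandwich a (smult Q (counit Q f') b) (x * f) y z
          = sandwich a b (x * counit_second f f') y z"
      proof (cases "p = 0")
        case True
        then show ?thesis by (simp add: smult_mult_left smult_mult_right antipode_smult)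
      next
        case False
        then have "counit Q f' = 0"
          using counit_grade[of f'] v(4) by simp
        then show ?thesis by (simp add: antipode_zero)
      qed
      finally show ?case by (simp add: v)
    next
      case (diff s s')
      then show ?case
        by (simp add: frag_extend_diff fmult_diff_right feval_diff antipode_diff left_diff_distrib right_diff_distrib)
    qed
    then show ?case by (simp add: w one)
  qed (simp_all add: fmult_diff_left feval_diff)
  then show ?thesis
    unfolding contract3_def by (simp add: U T comult_at_tclass tmult_tclass contract_sandwich)
qed

section \<open>Twisting\<close>

text \<open>If \<open>F\<close> is homogeneous of degree \<open>d\<close>, then so is \<open>\<Sum> \<epsilon>(f) f'\<close>, because only terms with even \<open>f\<close>
survive. But this element is \<open>1\<close>, which is nonzero and even.\<close>

lemma twistor_even:
  assumes "twistor Q F" shows "F \<in> tgrade Q 2 0"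
proof -
  obtain d where "F \<in> tgrade Q 2 d"
    using assms by (auto simp: twistor_def)
  then obtain s where F: "F = tclass Q s" and s: "homog (\<lambda>ds. length ds = 2 \<and> sum_list ds = d) s"
    by (auto simp: tgrade_iff)
  let ?e = "\<lambda>w. case w of [x, y] \<Rightarrow> counit_first x y | _ \<Rightarrow> 0"
  have "feval ?e s \<in> grade Q d"
    using s
  proof (induction rule: homog_induct)
    case (word ds w)
    obtain p q x y where w: "ds = [p, q]" "w = [x, y]" "x \<in> grade Q p" "y \<in> grade Q q"
      using hom_word_2E[OF word(1)] word(2) by metis
    show ?case
    proof (cases "p = 0")
      case True
      then show ?thesis using w word(2) by (auto simp: grade_smult)
    next
      case False
      then have "counit Q x = 0"
        using counit_grade[of x] w(3) by simp
      then show ?thesis by (simp add: w(2))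
    qed
  qed (simp_all add: feval_diff grade_diff)
  moreover have "feval ?e s = contract2 counit_first F"
    by (simp add: F contract2_def contract_tclass[OF multilinear_counit_first])
  moreover have "contract2 counit_first F = 1"
    using contract_counit[of 0 F] assms by (simp add: twistor_def)
  ultimately have "1 \<in> grade Q d"
    by simp
  then have "d = 0"
    using grade_disjoint[OF grade_one] by (cases d) auto
  with \<open>F \<in> tgrade Q 2 d\<close> show ?thesis by simp
qed

text \<open>The common source of both invariance statements: \<open>a\<close> and \<open>b\<close> stand for \<open>\<alpha>\<close> and \<open>c\<^sub>1\<close>, or for
\<open>c\<^sub>2\<close> and \<open>\<beta>\<close>.\<close>

lemma sandwich_twisted_coassoc:
  assumes F: "twistor Q F"
    and a: "\<And>x. contract2 (left_bracket a) (comult Q x) = smult Q (counit Q x) a"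
    and b: "\<And>x. contract2 (right_bracket b) (comult Q x) = smult Q (counit Q x) b"
  shows "contract3 (sandwich (contract2 (left_bracket a) (tinverse Q 2 F)) (contract2 (right_bracket b) F))
           (coassoc (twist Q F)) = contract3 (sandwich a b) (coassoc Q)"
proof -
  define G where "G = tinverse Q 2 F"
  define P where "P = coassoc Q"
  have F_even: "F \<in> tgrade Q 2 0"
    by (rule twistor_even[OF F])
  have F2: "F \<in> tpower Q 2"
    by (rule tgrade_tpower[OF F_even])
  have G_inv: "is_tinverse Q 2 F G"
    using F unfolding G_def by (intro tinverse_is_tinverse) (simp add: twistor_def)
  then have G_even: "G \<in> tgrade Q 2 0" and FG: "F \<odot> G = tone Q 2" and GF: "G \<odot> F = tone Q 2"
    using tinverse_even[OF F_even] by (auto simp: is_tinverse_def)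
  have G2: "G \<in> tpower Q 2"
    by (rule tgrade_tpower[OF G_even])
  have counit_F: "contract2 counit_first F = 1" "contract2 counit_second F = 1"
    using contract_counit[of 0 F] contract_counit[of 1 F] F by (simp_all add: twistor_def)
  have "contract2 counit_second (tone Q 2) = 1"
    by (simp add: tone_def pure_def contract2_def contract_tclass[OF multilinear_counit_second]
        numeral_2_eq_2 counit_one)
  then have counit_G: "contract2 counit_second G = 1"
    using contract_counit_second_mult[OF F_even G2] by (simp add: FG counit_F)
  let ?F1 = "F \<otimes> pure Q [1]" and ?G1 = "G \<otimes> pure Q [1]"
  let ?F2 = "pure Q [1] \<otimes> F" and ?G2 = "pure Q [1] \<otimes> G"
  define D where "D = comult_at Q 0 F"
  define E where "E = comult_at Q 1 G"
  have one: "pure Q [1] \<in> tpower Q 1"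
    using tone_tpower[of 1] by (simp add: tone_def)
  have P: "P \<in> tpower Q 3"
    using coassoc_invertible by (simp add: P_def tinvertible_def)
  have mem: "?F1 \<in> tpower Q 3" "?G1 \<in> tpower Q 3" "?F2 \<in> tpower Q 3" "?G2 \<in> tpower Q 3"
    "D \<in> tpower Q 3" "E \<in> tpower Q 3"
    using tjoin_tpower[OF F2 one] tjoin_tpower[OF G2 one] tjoin_tpower[OF one F2] tjoin_tpower[OF one G2]
      comult_at_tpower[OF F2, of 0] comult_at_tpower[OF G2, of 1] by (simp_all add: D_def E_def numeral_3_eq_3 numeral_2_eq_2)
  note mem' = mem P tmult_tpower
  have "tone Q 2 \<otimes> pure Q [1] = tone Q 3" "pure Q [1] \<otimes> tone Q 2 = tone Q 3"
    by (simp_all add: tone_def pure_def tjoin_tclass numeral_3_eq_3 numeral_2_eq_2)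
  then have cancel: "?G1 \<odot> ?F1 = tone Q 3" "?G2 \<odot> ?F2 = tone Q 3"
    using tjoin_one_tmult[OF G2 F2] one_tjoin_tmult[OF G2 F2] by (simp_all add: GF)
  have coassoc: "coassoc (twist Q F) = ?F1 \<odot> D \<odot> P \<odot> E \<odot> ?G2"
    by (simp add: twist_def G_def P_def D_def E_def)
  have "contract3 (sandwich (contract2 (left_bracket a) G) (contract2 (right_bracket b) F)) (coassoc (twist Q F))
      = contract3 (sandwich a (contract2 (right_bracket b) F)) (?G1 \<odot> coassoc (twist Q F))"
    by (rule sandwich_left_factor[OF G_even, symmetric]) (simp add: coassoc mem')
  also have "?G1 \<odot> coassoc (twist Q F) = (?G1 \<odot> ?F1) \<odot> (D \<odot> P \<odot> E \<odot> ?G2)"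
    by (simp add: coassoc tmult_assoc[of _ 3] mem')
  also have "\<dots> = D \<odot> P \<odot> E \<odot> ?G2"
    by (simp add: cancel tone_tmult mem')
  also have "contract3 (sandwich a (contract2 (right_bracket b) F)) (D \<odot> P \<odot> E \<odot> ?G2)
      = contract3 (sandwich a b) (D \<odot> P \<odot> E \<odot> ?G2 \<odot> ?F2)"
    by (rule sandwich_right_factor[OF F_even, symmetric]) (simp add: mem')
  also have "D \<odot> P \<odot> E \<odot> ?G2 \<odot> ?F2 = D \<odot> (P \<odot> E)"
    by (simp add: tmult_assoc[of _ 3] mem' cancel tmult_tone)
  also have "contract3 (sandwich a b) (D \<odot> (P \<odot> E)) = contract3 (sandwich a b) (P \<odot> E)"
    unfolding D_def by (rule sandwich_comult_left[OF a F_even counit_F(1)]) (simp add: mem')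
  also have "\<dots> = contract3 (sandwich a b) P"
    unfolding E_def by (rule sandwich_comult_right[OF b G_even counit_G P])
  finally show ?thesis
    by (simp add: G_def P_def)
qed

text \<open>For even \<open>c\<close> the signs in the definition of invariance are trivial, and the equation takes the form
of the antipode axiom for \<open>\<beta>\<close>.\<close>

lemma invariant_even:
  assumes "invariant Q c" "c \<in> grade Q 0"
  shows "contract2 (right_bracket c) (comult Q x) = smult Q (counit Q x) c"
proof -
  have "(\<lambda>x y. \<Sum>d\<in>UNIV. \<Sum>e\<in>UNIV. of_int (sign (d * e)) *
          (x * component Q d c * antipode Q (component Q e y))) = right_bracket c"
    using component_homogeneous[OF assms(2)]
    by (simp add: UNIV_bit fun_eq_iff component_sum flip: distrib_left antipode_add)
  then show ?thesis
    using assms(1) by (simp add: invariant_def)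
qed

lemma pseudo_invariant_even:
  assumes "pseudo_invariant Q c" "c \<in> grade Q 0"
  shows "contract2 (left_bracket c) (comult Q x) = smult Q (counit Q x) c"
proof -
  have "(\<lambda>x y. \<Sum>d\<in>UNIV. \<Sum>e\<in>UNIV. of_int (sign (d * e)) *
          (antipode Q (component Q e x) * component Q d c * y)) = left_bracket c"
    using component_homogeneous[OF assms(2)]
    by (simp add: UNIV_bit fun_eq_iff component_sum flip: distrib_right antipode_add)
  then show ?thesis
    using assms(1) by (simp add: pseudo_invariant_def)
qed

end

theorem theorem3:
  fixes Q :: "('k::field, 'a::ring_1) quasi_hopf_data"
    and c1 c2 :: 'a
    and F :: "'a tensor"
  assumes "quasi_hopf_superalgebra Q"
    and "c1 \<in> grade Q 0" and "invariant Q c1"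
    and "c2 \<in> grade Q 0" and "pseudo_invariant Q c2"
    and "twistor Q F"
  shows "central1 (twist Q F) (twist_invariant Q F c1) = central1 Q c1 \<and>
         central2 (twist Q F) (twist_pseudo_invariant Q F c2) = central2 Q c2"
proof -
  interpret quasi_hopf_superalgebra Q
    by (rule assms(1))
  show ?thesis
    using sandwich_twisted_coassoc[OF assms(6) antipode_alpha invariant_even[OF assms(3,2)]]
      sandwich_twisted_coassoc[OF assms(6) pseudo_invariant_even[OF assms(5,4)] antipode_beta]
    by (simp add: central1_def central2_def twist_invariant_def twist_pseudo_invariant_def twist_def)
qed

end
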